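(* Let $A=KQ/I$ be an almost gentle algebra with set of maximal paths $\mathcal M$. Then \[\dim_K(A)=|Q_0|+\sum_{m\in\mathcal M}\frac{\ell(U_m)\,(\ell(U_m)+1)}{2},\] where $U_m$ is the uniserial right $A$-module generated by the first arrow in $m$ and $\ell(U_m)$ is its length.
   Context: $K$ is a field; all algebras are indecomposable and finite dimensional over $K$. Quivers are finite, $Q_0$ and $Q_1$ denote vertices and arrows; $ab$ denotes the arrow $a$ followed by the arrow $b$ (and is $0$ if not composable). For a presentation $KQ/I$ the ideal $I$ is admissible. An algebra is almost gentle if it is Morita equivalent to some $KQ/I$ such that (S0) $I$ is generated by paths of length 2, and (S1) for every $a\in Q_1$ there is at most one arrow $b$ with $ab\notin I$ and at most one arrow $c$ with $ca\notin I$. "Let $A=KQ/I$ be almost gentle" means that the presentation satisfies (S0) and (S1). A path $p$ in $Q$ is a maximal path of $A$ if $p\notin I$ and $ap\in I$ and $pa\in I$ for every $a\in Q_1$. For $m\in\mathcal M$ with first arrow $a$, $U_m=\overline aA$, where $\overline a$ is the image of $a$ in $A$. *)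

theory Defs
  imports "Graph_Theory.Arc_Walk" "HOL-Algebra.QuotRing" "HOL-Algebra.Ideal_Product"
    "HOL-Algebra.Embedded_Algebras"
begin

section \<open>Path algebras of quivers\<close>

text \<open>
  A finite quiver is a finite directed multigraph (\<^locale>\<open>fin_digraph\<close>).
  A path is a pair \<open>(u, p)\<close> of its source vertex and its list of arrows, in the order in which
  they are traversed; the source is recorded so that \<open>(u, [])\<close> is the trivial path at \<open>u\<close>.
\<close>

definition quiver_paths :: "('v, 'e) pre_digraph \<Rightarrow> ('v \<times> 'e list) set" where
  "quiver_paths G = {(u, p). \<exists>v. pre_digraph.awalk G u p v}"

text \<open>
  Elements of the path algebra over the field \<open>'k\<close> are finitely supported families of coefficients.
  The product extends concatenation of paths bilinearly (first factor traversed first): the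
  coefficient at \<open>(u, p)\<close> is the sum over all factorizations of \<open>(u, p)\<close> into two paths.
\<close>

definition path_algebra :: "('v, 'e) pre_digraph \<Rightarrow> ('v \<times> 'e list \<Rightarrow> 'k::field) ring" where
  "path_algebra G =
    \<lparr>carrier = {f. finite {x. f x \<noteq> 0} \<and> {x. f x \<noteq> 0} \<subseteq> quiver_paths G},
     mult = (\<lambda>f g (u, p). \<Sum>i\<le>length p.
               f (u, take i p) * g (pre_digraph.awlast G u (take i p), drop i p)),
     one = (\<lambda>(u, p). if u \<in> verts G \<and> p = [] then 1 else 0),
     zero = (\<lambda>_. 0),
     add = (\<lambda>f g x. f x + g x)\<rparr>"

definition path_elem :: "'v \<times> 'e list \<Rightarrow> ('v \<times> 'e list \<Rightarrow> 'k::field)" where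
  "path_elem x = (\<lambda>y. if y = x then 1 else 0)"

definition arrow_elem :: "('v, 'e) pre_digraph \<Rightarrow> 'e \<Rightarrow> ('v \<times> 'e list \<Rightarrow> 'k::field)" where
  "arrow_elem G a = path_elem (tail G a, [a])"

definition arrow_ideal :: "('v, 'e) pre_digraph \<Rightarrow> ('v \<times> 'e list \<Rightarrow> 'k::field) set" where
  "arrow_ideal G = Idl\<^bsub>path_algebra G\<^esub> (arrow_elem G ` arcs G)"

definition admissible_ideal ::
  "('v, 'e) pre_digraph \<Rightarrow> ('v \<times> 'e list \<Rightarrow> 'k::field) set \<Rightarrow> bool" where
  "admissible_ideal G I \<longleftrightarrow> ideal I (path_algebra G) \<and>
     I \<subseteq> arrow_ideal G [^]\<^bsub>ideals_set (path_algebra G)\<^esub> (2::nat) \<and>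
     (\<exists>m\<ge>2::nat. arrow_ideal G [^]\<^bsub>ideals_set (path_algebra G)\<^esub> m \<subseteq> I)"

abbreviation quiver_algebra ::
  "('v, 'e) pre_digraph \<Rightarrow> ('v \<times> 'e list \<Rightarrow> 'k::field) set \<Rightarrow> ('v \<times> 'e list \<Rightarrow> 'k) set ring" where
  "quiver_algebra G I \<equiv> path_algebra G Quot I"

text \<open>
  The copy of the field \<open>'k\<close> inside \<open>KQ/I\<close>, i.e. the image of the structure map; the dimension
  over \<open>K\<close> is \<^const>\<open>ring.dimension\<close> over this subfield.
\<close>

definition base_field ::
  "('v, 'e) pre_digraph \<Rightarrow> ('v \<times> 'e list \<Rightarrow> 'k::field) set \<Rightarrow> ('v \<times> 'e list \<Rightarrow> 'k) set set" where
  "base_field G I = range (\<lambda>c. I +>\<^bsub>path_algebra G\<^esub> (\<lambda>x. c * \<one>\<^bsub>path_algebra G\<^esub> x))"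

text \<open>
  Indecomposability as a ring: nonzero and not the internal direct product of two nonzero
  two-sided ideals. In a \<open>K\<close>-algebra all ideals are \<open>K\<close>-subspaces.
\<close>

definition indecomposable_ring :: "('a, 'm) ring_scheme \<Rightarrow> bool" where
  "indecomposable_ring A \<longleftrightarrow> carrier A \<noteq> {\<zero>\<^bsub>A\<^esub>} \<and>
     \<not> (\<exists>J L. ideal J A \<and> ideal L A \<and> J \<noteq> {\<zero>\<^bsub>A\<^esub>} \<and> L \<noteq> {\<zero>\<^bsub>A\<^esub>} \<and>
          J \<inter> L = {\<zero>\<^bsub>A\<^esub>} \<and> J <+>\<^bsub>A\<^esub> L = carrier A)"


section \<open>Almost gentle presentations and maximal paths\<close>

text \<open>The product of two arrows that are not composable is zero, hence lies in \<open>I\<close>.\<close>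

definition almost_gentle ::
  "('v, 'e) pre_digraph \<Rightarrow> ('v \<times> 'e list \<Rightarrow> 'k::field) set \<Rightarrow> bool" where
  "almost_gentle G I \<longleftrightarrow>
     (\<exists>S \<subseteq> {x \<in> quiver_paths G. length (snd x) = 2}. I = Idl\<^bsub>path_algebra G\<^esub> (path_elem ` S)) \<and>
     (\<forall>a\<in>arcs G.
        (\<exists>\<^sub>\<le>\<^sub>1b. b \<in> arcs G \<and> arrow_elem G a \<otimes>\<^bsub>path_algebra G\<^esub> arrow_elem G b \<notin> I) \<and>
        (\<exists>\<^sub>\<le>\<^sub>1c. c \<in> arcs G \<and> arrow_elem G c \<otimes>\<^bsub>path_algebra G\<^esub> arrow_elem G a \<notin> I))"

definition maximal_paths ::
  "('v, 'e) pre_digraph \<Rightarrow> ('v \<times> 'e list \<Rightarrow> 'k::field) set \<Rightarrow> ('v \<times> 'e list) set" where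
  "maximal_paths G I = {m \<in> quiver_paths G. path_elem m \<notin> I \<and>
     (\<forall>a\<in>arcs G. arrow_elem G a \<otimes>\<^bsub>path_algebra G\<^esub> path_elem m \<in> I \<and>
                 path_elem m \<otimes>\<^bsub>path_algebra G\<^esub> arrow_elem G a \<in> I)}"


section \<open>Right submodules of the regular module\<close>

definition right_submodule :: "('a, 'm) ring_scheme \<Rightarrow> 'a set \<Rightarrow> bool" where
  "right_submodule A N \<longleftrightarrow> additive_subgroup N A \<and> (\<forall>x\<in>N. \<forall>a\<in>carrier A. x \<otimes>\<^bsub>A\<^esub> a \<in> N)"

definition uniserial :: "('a, 'm) ring_scheme \<Rightarrow> 'a set \<Rightarrow> bool" where
  "uniserial A U \<longleftrightarrow> right_submodule A U \<and>
     (\<forall>N N'. right_submodule A N \<and> N \<subseteq> U \<and> right_submodule A N' \<and> N' \<subseteq> U \<longrightarrow> N \<subseteq> N' \<or> N' \<subseteq> N)"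

text \<open>
  A quotient \<open>N'/N\<close> of submodules is simple iff \<open>N \<subset> N'\<close> and no submodule lies strictly in between.
\<close>

definition composition_series :: "('a, 'm) ring_scheme \<Rightarrow> 'a set \<Rightarrow> 'a set list \<Rightarrow> bool" where
  "composition_series A U Ns \<longleftrightarrow>
     Ns \<noteq> [] \<and> hd Ns = {\<zero>\<^bsub>A\<^esub>} \<and> last Ns = U \<and> (\<forall>N\<in>set Ns. right_submodule A N) \<and>
     (\<forall>i. Suc i < length Ns \<longrightarrow>
        Ns ! i \<subset> Ns ! Suc i \<and> \<not> (\<exists>N. right_submodule A N \<and> Ns ! i \<subset> N \<and> N \<subset> Ns ! Suc i))"

definition module_length :: "('a, 'm) ring_scheme \<Rightarrow> 'a set \<Rightarrow> nat" where
  "module_length A U = (THE n. \<exists>Ns. composition_series A U Ns \<and> length Ns = Suc n)"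

text \<open>
  The right module generated by the first arrow of a path. A trivial path has no first arrow, and
  gets the zero module; it can be a maximal path only at an isolated vertex, so for indecomposable
  \<open>KQ/I\<close> only when the quiver is a single vertex without arrows and \<open>KQ/I = K\<close>.
\<close>

definition first_arrow_module ::
  "('v, 'e) pre_digraph \<Rightarrow> ('v \<times> 'e list \<Rightarrow> 'k::field) set \<Rightarrow> 'v \<times> 'e list
    \<Rightarrow> ('v \<times> 'e list \<Rightarrow> 'k) set set" where
  "first_arrow_module G I m =
     (case snd m of
        [] \<Rightarrow> {\<zero>\<^bsub>quiver_algebra G I\<^esub>}
      | a # _ \<Rightarrow> {(I +>\<^bsub>path_algebra G\<^esub> arrow_elem G a) \<otimes>\<^bsub>quiver_algebra G I\<^esub> x |x.
                    x \<in> carrier (quiver_algebra G I)})"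

end

theory Submission
  imports Defs
begin

text \<open>
  Since \<open>I\<close> is generated by paths, it consists of the elements of the path algebra that vanish on all
  paths outside \<open>I\<close>, so the classes of these nonzero paths form a basis of \<open>KQ/I\<close>. The nonzero
  trivial paths account for \<open>|Q\<^sub>0|\<close>. Nonzero paths of positive length are chains of the relation
  \<open>ab \<notin> I\<close> on arrows, which by (S1) is a partial injection; as chains have bounded length, each chain
  is an interval of exactly one maximal chain, in exactly one position, and a chain of length \<open>n\<close> has
  \<open>n(n+1)/2\<close> nonempty intervals. Finally, if \<open>m\<close> is a maximal path of length \<open>n \<ge> 1\<close>, the nonempty
  initial segments of \<open>m\<close> form a basis of \<open>U\<^sub>m\<close>, and its submodules are the spans of the initial
  segments of length at least \<open>k\<close>, so that \<open>U\<^sub>m\<close> is uniserial of length \<open>n\<close>.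
\<close>

section \<open>Chains of a partial injection\<close>

lemma not_successivelyE:
  assumes "\<not> successively R p"
  obtains xs a b ys where "p = xs @ a # b # ys" "\<not> R a b"
proof -
  from assms obtain i where "Suc i < length p" "\<not> R (p ! i) (p ! Suc i)"
    by (auto simp: successively_conv_nth)
  then show thesis
    using that[of "take i p" "p ! i" "p ! Suc i" "drop (Suc (Suc i)) p"]
    by (simp add: Cons_nth_drop_Suc)
qed

text \<open>The finiteness assumption excludes cycles of \<open>R\<close> in \<open>X\<close>,
  around which a chain could be extended forever.\<close>

locale partial_injection =
  fixes X :: "'a set" and R :: "'a \<Rightarrow> 'a \<Rightarrow> bool"
  assumes right_unique: "R a b \<Longrightarrow> R a b' \<Longrightarrow> b = b'"
    and left_unique: "R a b \<Longrightarrow> R a' b \<Longrightarrow> a = a'"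
    and finite_successively: "finite {p. set p \<subseteq> X \<and> successively R p}"
begin

definition chains :: "'a list set" where
  "chains = {p. p \<noteq> [] \<and> set p \<subseteq> X \<and> successively R p}"

definition maximal_chains :: "'a list set" where
  "maximal_chains = {p \<in> chains. \<forall>a\<in>X. \<not> R a (hd p) \<and> \<not> R (last p) a}"

lemma finite_chains: "finite chains"
  using finite_subset[OF _ finite_successively] by (auto simp: chains_def)

text \<open>A chain that is not maximal can be lengthened by one element at one of its ends, and the
  lengths of the finitely many chains are bounded. Hence the induction on
  \<open>N - length p\<close>.\<close>

lemma extend_to_maximal:
  assumes "p \<in> chains"
  obtains xs ys where "xs @ p @ ys \<in> maximal_chains"
proof -
  obtain N where N: "\<And>p. p \<in> chains \<Longrightarrow> length p < N"
    using finite_maxlen[OF finite_chains] by blast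
  have "\<exists>xs ys. xs @ p @ ys \<in> maximal_chains"
    using assms
  proof (induction "N - length p" arbitrary: p rule: less_induct)
    case less
    show ?case
    proof (cases "p \<in> maximal_chains")
      case True
      then have "[] @ p @ [] \<in> maximal_chains" by simp
      then show ?thesis by blast
    next
      case False
      then obtain a where a: "a \<in> X" "R a (hd p) \<or> R (last p) a"
        using less.prems by (auto simp: maximal_chains_def)
      have *: "N - Suc (length p) < N - length p"
        using N[OF less.prems] by simp
      from a(2) show ?thesis
      proof
        assume "R a (hd p)"
        then have "a # p \<in> chains"
          using less.prems a(1) by (auto simp: chains_def successively_Cons)
        then obtain xs ys where "xs @ (a # p) @ ys \<in> maximal_chains"
          using less.hyps[of "a # p"] * by auto
        then have "(xs @ [a]) @ p @ ys \<in> maximal_chains" by simp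
        then show ?thesis by blast
      next
        assume "R (last p) a"
        then have "p @ [a] \<in> chains"
          using less.prems a(1) by (auto simp: chains_def successively_append_iff)
        then obtain xs ys where "xs @ (p @ [a]) @ ys \<in> maximal_chains"
          using less.hyps[of "p @ [a]"] * by auto
        then have "xs @ p @ (a # ys) \<in> maximal_chains" by simp
        then show ?thesis by blast
      qed
    qed
  qed
  then show thesis using that by blast
qed

section \<open>Rigidity of maximal chains\<close>

lemma maximal_chain_backwards:
  assumes "p \<in> maximal_chains" "q \<in> maximal_chains" "i < length p" "j < length q" "p ! i = q ! j"
    and "k \<le> i" "k \<le> j"
  shows "p ! (i - k) = q ! (j - k)"
  using \<open>k \<le> i\<close> \<open>k \<le> j\<close>
proof (induction k)
  case 0
  then show ?case using assms by simp
next
  case (Suc k)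
  then have "p ! Suc (i - Suc k) = q ! Suc (j - Suc k)"
    by (simp add: Suc_diff_Suc)
  moreover have "R (p ! (i - Suc k)) (p ! Suc (i - Suc k))" "R (q ! (j - Suc k)) (q ! Suc (j - Suc k))"
    using assms Suc.prems by (auto simp: maximal_chains_def chains_def successively_conv_nth)
  ultimately show ?case using left_unique by metis
qed

text \<open>If \<open>j\<close> exceeded \<open>i\<close>, walking back \<open>i\<close> steps from
  the common entry would reach the start of \<open>p\<close> at a positive position of
  \<open>q\<close>; its predecessor in \<open>q\<close> would then extend \<open>p\<close> to the
  left.\<close>

lemma maximal_chain_position_le:
  assumes "p \<in> maximal_chains" "q \<in> maximal_chains" "i < length p" "j < length q" "p ! i = q ! j"
  shows "j \<le> i"
proof (rule ccontr)
  assume "\<not> j \<le> i"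
  then have less: "i < j" by simp
  then have "hd p = q ! Suc (j - Suc i)"
    using maximal_chain_backwards[OF assms, of i] assms(1)
    by (simp add: maximal_chains_def chains_def hd_conv_nth Suc_diff_Suc)
  moreover have "R (q ! (j - Suc i)) (q ! Suc (j - Suc i))" "q ! (j - Suc i) \<in> X"
    using assms less by (auto simp: maximal_chains_def chains_def successively_conv_nth)
  ultimately show False using assms(1) by (auto simp: maximal_chains_def)
qed

lemma maximal_chain_forwards:
  assumes "p \<in> maximal_chains" "q \<in> maximal_chains" "p ! 0 = q ! 0"
    and "k < length p" "k < length q"
  shows "p ! k = q ! k"
  using \<open>k < length p\<close> \<open>k < length q\<close>
proof (induction k)
  case 0
  then show ?case using assms by simp
next
  case (Suc k)
  moreover have "R (p ! k) (p ! Suc k)" "R (q ! k) (q ! Suc k)"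
    using assms Suc.prems by (auto simp: maximal_chains_def chains_def successively_conv_nth)
  ultimately show ?case using right_unique by (metis Suc_lessD)
qed

text \<open>Were \<open>p\<close> longer, its entry at position \<open>length q\<close> would extend
  \<open>q\<close> to the right.\<close>

lemma maximal_chain_length_le:
  assumes "p \<in> maximal_chains" "q \<in> maximal_chains" "p ! 0 = q ! 0"
  shows "length p \<le> length q"
proof (rule ccontr)
  assume "\<not> length p \<le> length q"
  then have less: "length q < length p" by simp
  have ne: "q \<noteq> []" using assms(2) by (auto simp: maximal_chains_def chains_def)
  then have "last q = p ! (length q - 1)"
    using maximal_chain_forwards[OF assms, of "length q - 1"] less by (simp add: last_conv_nth)
  moreover have "R (p ! (length q - 1)) (p ! Suc (length q - 1))" "p ! Suc (length q - 1) \<in> X"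
    using assms(1) less ne nth_mem[of "length q" p]
    by (auto simp: maximal_chains_def chains_def successively_conv_nth simp del: nth_mem
        dest!: spec[of _ "length q - 1"])
  ultimately show False using assms(2) by (auto simp: maximal_chains_def)
qed

text \<open>Walking back from the common entry aligns the two starts, from where the chains agree up
  to their common length. The case \<open>p = q\<close> says that the entries of a maximal chain are
  distinct.\<close>

lemma maximal_chain_unique:
  assumes "p \<in> maximal_chains" "q \<in> maximal_chains" "i < length p" "j < length q" "p ! i = q ! j"
  shows "i = j" "p = q"
proof -
  show ij: "i = j"
    using maximal_chain_position_le[OF assms] maximal_chain_position_le[of q p j i] assms by simp
  then have 0: "p ! 0 = q ! 0" using maximal_chain_backwards[OF assms, of i] by simp
  then have "length p = length q"
    using maximal_chain_length_le assms(1,2) by (simp add: le_antisym)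
  then show "p = q"
    using maximal_chain_forwards[OF assms(1,2) 0] by (simp add: nth_equalityI)
qed

text \<open>Right uniqueness forces each element of \<open>q\<close> to be the next entry of
  \<open>p\<close>, and maximality of \<open>p\<close> leaves none beyond its end. This later makes
  spans of initial segments closed under right multiplication.\<close>

lemma maximal_chain_extension:
  assumes "p \<in> maximal_chains" "0 < l" "l \<le> length p"
    and "successively R (take l p @ q)" "set q \<subseteq> X"
  shows "\<exists>l'\<in>{l..length p}. take l p @ q = take l' p"
  using assms(2-)
proof (induction q arbitrary: l)
  case Nil
  then show ?case by auto
next
  case (Cons b q)
  have last: "last (take l p) = p ! (l - 1)"
    using Cons.prems by (subst last_conv_nth) auto
  then have b: "R (p ! (l - 1)) b" "b \<in> X"
    using Cons.prems by (auto simp: successively_append_iff)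
  then have less: "l < length p"
    using assms(1) Cons.prems last by (cases "l = length p") (auto simp: maximal_chains_def)
  moreover have "R (p ! (l - 1)) (p ! Suc (l - 1))"
    using assms(1) less Cons.prems(1)
    by (auto simp: maximal_chains_def chains_def successively_conv_nth dest!: spec[of _ "l - 1"])
  ultimately have "take l p @ b # q = take (Suc l) p @ q"
    using right_unique[OF b(1)] Cons.prems(1) by (simp add: take_Suc_conv_app_nth)
  with Cons.IH[of "Suc l"] Cons.prems less show ?case by fastforce
qed

text \<open>The triple \<open>(m, i, k)\<close> encodes the interval of \<open>m\<close> that starts
  at \<open>i\<close> and has length \<open>Suc k\<close>. Every chain is such an interval by
  extension to a maximal chain; its first entry determines \<open>m\<close> and \<open>i\<close>,
  and its length determines \<open>k\<close>.\<close>

lemma bij_betw_subchains: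
  "bij_betw (\<lambda>(m, i, k). take (Suc k) (drop i m))
     (SIGMA m:maximal_chains. SIGMA i:{..<length m}. {..<length m - i}) chains"
  unfolding bij_betw_def
proof
  show "inj_on (\<lambda>(m, i, k). take (Suc k) (drop i m))
     (SIGMA m:maximal_chains. SIGMA i:{..<length m}. {..<length m - i})"
  proof (rule inj_onI, clarsimp)
    fix m i k m' i' k'
    assume A: "m \<in> maximal_chains" "m' \<in> maximal_chains" "i < length m" "k < length m - i"
      "i' < length m'" "k' < length m' - i'" and eq: "take (Suc k) (drop i m) = take (Suc k') (drop i' m')"
    from arg_cong[OF eq, of length] A have "k = k'" by simp
    moreover have "m ! i = m' ! i'" using arg_cong[OF eq, of hd] A by (simp add: hd_drop_conv_nth)
    ultimately show "m = m' \<and> i = i' \<and> k = k'"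
      using maximal_chain_unique A by metis
  qed
next
  show "(\<lambda>(m, i, k). take (Suc k) (drop i m)) `
     (SIGMA m:maximal_chains. SIGMA i:{..<length m}. {..<length m - i}) = chains"
  proof (intro subset_antisym subsetI)
    fix p assume "p \<in> chains"
    moreover from this obtain xs ys where m: "xs @ p @ ys \<in> maximal_chains" by (rule extend_to_maximal)
    ultimately have "p = (\<lambda>(m, i, k). take (Suc k) (drop i m)) (xs @ p @ ys, length xs, length p - 1)"
      and "0 < length p"
      by (auto simp: chains_def)
    with m show "p \<in> (\<lambda>(m, i, k). take (Suc k) (drop i m)) `
     (SIGMA m:maximal_chains. SIGMA i:{..<length m}. {..<length m - i})"
      by (intro rev_image_eqI[of "(xs @ p @ ys, length xs, length p - 1)"]) (auto intro: trans_less_add1)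
  next
    fix p assume "p \<in> (\<lambda>(m, i, k). take (Suc k) (drop i m)) `
     (SIGMA m:maximal_chains. SIGMA i:{..<length m}. {..<length m - i})"
    then obtain m i k where m: "m \<in> maximal_chains" "i < length m" "p = take (Suc k) (drop i m)"
      by auto
    moreover from this have "set p \<subseteq> set m"
      by (metis order_trans set_drop_subset set_take_subset)
    ultimately show "p \<in> chains"
      by (auto simp: maximal_chains_def chains_def successively_conv_nth)
  qed
qed

lemma card_chains: "card chains = (\<Sum>m\<in>maximal_chains. length m * (length m + 1) div 2)"
proof -
  have fin: "finite maximal_chains"
    using finite_chains by (simp add: maximal_chains_def)
  have "card chains = card (SIGMA m:maximal_chains. SIGMA i:{..<length m}. {..<length m - i})"
    using bij_betw_same_card[OF bij_betw_subchains] by simp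
  also have "\<dots> = (\<Sum>m\<in>maximal_chains. \<Sum>i<length m. length m - i)"
    using fin by (simp add: card_SigmaI)
  also have "\<dots> = (\<Sum>m\<in>maximal_chains. length m * (length m + 1) div 2)"
  proof (rule sum.cong[OF refl])
    fix m :: "'a list"
    \<comment> \<open>A chain of length \<open>n\<close> has \<open>n - i\<close> nonempty intervals
      starting at position \<open>i\<close>; in reverse order these numbers are 1, ...,
      \<open>n\<close>.\<close>
    have "(\<Sum>i<n. n - i) = \<Sum> {0..n}" for n :: nat
    proof -
      have "(\<Sum>i<n. n - i) = (\<Sum>i<n. Suc i)"
        by (subst sum.nat_diff_reindex[symmetric]) (auto intro!: sum.cong)
      also have "\<dots> = \<Sum> {0..n}"
        by (induction n) auto
      finally show ?thesis .
    qed
    then show "(\<Sum>i<length m. length m - i) = length m * (length m + 1) div 2"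
      by (simp add: gauss_sum_nat mult.commute)
  qed
  finally show ?thesis .
qed

end

section \<open>Modules whose submodules form a finite chain\<close>

lemma psubset_chain:
  fixes C :: "nat \<Rightarrow> 'a set"
  assumes "\<And>i. i < n \<Longrightarrow> C i \<subset> C (Suc i)" "i < j" "j \<le> n"
  shows "C i \<subset> C j"
  using assms(2,3)
proof (induction j)
  case (Suc j)
  then show ?case using assms(1)[of j] by (cases "i = j") auto
qed simp

text \<open>Any two members of a chain are comparable. As \<open>module_length\<close> is a definite
  description, its value also requires all composition series to have the same length: since each
  submodule is some \<open>C i\<close>, such a series must coincide with \<open>C\<close> step by
  step.\<close>

lemma uniserial_if_submodules_chain:
  fixes A :: "('a, 'm) ring_scheme" and C :: "nat \<Rightarrow> 'a set"
  assumes bottom: "C 0 = {\<zero>\<^bsub>A\<^esub>}" and top: "C n = U"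
    and submodule: "\<And>i. i \<le> n \<Longrightarrow> right_submodule A (C i)"
    and step: "\<And>i. i < n \<Longrightarrow> C i \<subset> C (Suc i)"
    and only: "\<And>N. right_submodule A N \<Longrightarrow> N \<subseteq> U \<Longrightarrow> \<exists>i\<le>n. N = C i"
  shows "uniserial A U" and "module_length A U = n"
proof -
  have less: "C i \<subset> C j" if "i < j" "j \<le> n" for i j
    using psubset_chain[of n C i j] step that by blast
  have le: "C i \<subseteq> C j" if "i \<le> j" "j \<le> n" for i j
    using less[of i j] that by (cases "i = j") auto
  show "uniserial A U"
    unfolding uniserial_def
  proof (intro conjI allI impI)
    show "right_submodule A U" using submodule[of n] top by simp
    fix N N' assume "right_submodule A N \<and> N \<subseteq> U \<and> right_submodule A N' \<and> N' \<subseteq> U"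
    then obtain i j where "i \<le> n" "N = C i" "j \<le> n" "N' = C j" using only by meson
    then show "N \<subseteq> N' \<or> N' \<subseteq> N" using le by (cases "i \<le> j") auto
  qed
  have "composition_series A U (map C [0..<Suc n])"
    unfolding composition_series_def
  proof (intro conjI allI impI ballI notI)
    show "hd (map C [0..<Suc n]) = {\<zero>\<^bsub>A\<^esub>}" using bottom by (simp add: hd_map del: upt_Suc)
    show "last (map C [0..<Suc n]) = U" using top by simp
    fix i assume i: "Suc i < length (map C [0..<Suc n])"
    then have nth: "map C [0..<Suc n] ! i = C i" "map C [0..<Suc n] ! Suc i = C (Suc i)"
      by (simp_all del: upt_Suc)
    show "map C [0..<Suc n] ! i \<subset> map C [0..<Suc n] ! Suc i"
      using step[of i] i nth by simp
    assume "\<exists>N. right_submodule A N \<and> map C [0..<Suc n] ! i \<subset> N \<and> N \<subset> map C [0..<Suc n] ! Suc i"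
    then obtain N where N: "right_submodule A N" "C i \<subset> N" "N \<subset> C (Suc i)" using nth by auto
    then have "N \<subseteq> U" using le[of "Suc i" n] i top by auto
    with N obtain j where j: "j \<le> n" "N = C j" using only by blast
    then have "\<not> j \<le> i" "\<not> Suc i \<le> j" using N le[of j i] le[of "Suc i" j] i by auto
    then show False by simp
  qed (use submodule in auto)
  moreover have "k = n" if "composition_series A U Ns" "length Ns = Suc k" for Ns k
  proof -
    have Ns: "Ns \<noteq> []" "hd Ns = {\<zero>\<^bsub>A\<^esub>}" "last Ns = U"
      using that unfolding composition_series_def by blast+
    have sub: "right_submodule A (Ns ! i)" if "i < length Ns" for i
      using that \<open>composition_series A U Ns\<close> by (auto simp: composition_series_def)
    have ss: "Ns ! i \<subset> Ns ! Suc i"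
      and simple: "\<not> (\<exists>N. right_submodule A N \<and> Ns ! i \<subset> N \<and> N \<subset> Ns ! Suc i)"
      if "i < k" for i
      using that \<open>composition_series A U Ns\<close> \<open>length Ns = Suc k\<close> by (auto simp: composition_series_def)
    have "Ns ! k = U" using Ns \<open>length Ns = Suc k\<close> by (simp add: last_conv_nth)
    have top': "Ns ! i \<subseteq> U" if "i \<le> k" for i
      using psubset_chain[of k "(!) Ns" i k] ss that \<open>Ns ! k = U\<close>
      by (cases "i = k") auto
    have "i \<le> n \<and> Ns ! i = C i" if "i \<le> k" for i
      using that
    proof (induction i)
      case 0
      then show ?case using Ns bottom by (simp add: hd_conv_nth)
    next
      case (Suc i)
      then have i: "i \<le> n" "Ns ! i = C i" "i < k" by auto
      obtain j where j: "j \<le> n" "Ns ! Suc i = C j"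
        using only[OF sub[of "Suc i"] top'[of "Suc i"]] Suc.prems \<open>length Ns = Suc k\<close> by auto
      have "\<not> j \<le> i" using ss[OF i(3)] i j le[of j i] by auto
      \<comment> \<open>Skipping \<open>C (Suc i)\<close> would leave it strictly between two
        consecutive members of the series.\<close>
      moreover have "\<not> Suc i < j"
      proof
        assume "Suc i < j"
        then have "right_submodule A (C (Suc i))" "Ns ! i \<subset> C (Suc i)" "C (Suc i) \<subset> Ns ! Suc i"
          using submodule[of "Suc i"] less[of i "Suc i"] less[of "Suc i" j] i j by auto
        then show False using simple[OF i(3)] by blast
      qed
      ultimately have "j = Suc i" by simp
      with j show ?case by simp
    qed
    then have "k \<le> n" "C k = C n" using \<open>Ns ! k = U\<close> top by auto
    then show "k = n" using less[of k n] by (cases "k = n") auto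
  qed
  ultimately show "module_length A U = n"
    unfolding module_length_def
    by (intro the_equality) (use length_map[of C "[0..<Suc n]"] length_upt in \<open>metis diff_zero\<close>, blast)
qed

lemma (in ring) right_submodule_principal:
  assumes "a \<in> carrier R"
  shows "right_submodule R {a \<otimes> x |x. x \<in> carrier R}"
  unfolding right_submodule_def
proof (intro conjI ballI additive_subgroupI add.subgroupI)
  show "{a \<otimes> x |x. x \<in> carrier R} \<noteq> {}" by blast
  fix y assume "y \<in> {a \<otimes> x |x. x \<in> carrier R}"
  then obtain x where x: "y = a \<otimes> x" "x \<in> carrier R" by blast
  have "\<ominus> y = a \<otimes> (\<ominus> x)" using x assms by (simp add: r_minus)
  then show "\<ominus> y \<in> {a \<otimes> x |x. x \<in> carrier R}" using x by blast
  fix b assume "b \<in> carrier R"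
  then have "y \<otimes> b = a \<otimes> (x \<otimes> b)" "x \<otimes> b \<in> carrier R" using x assms by (simp_all add: m_assoc)
  then show "y \<otimes> b \<in> {a \<otimes> x |x. x \<in> carrier R}" by blast
next
  fix y z assume "y \<in> {a \<otimes> x |x. x \<in> carrier R}" "z \<in> {a \<otimes> x |x. x \<in> carrier R}"
  then obtain w x where "y = a \<otimes> w" "w \<in> carrier R" "z = a \<otimes> x" "x \<in> carrier R" by blast
  then have "y \<oplus> z = a \<otimes> (w \<oplus> x)" "w \<oplus> x \<in> carrier R" using assms by (simp_all add: r_distr)
  then show "y \<oplus> z \<in> {a \<otimes> x |x. x \<in> carrier R}" by blast
qed (use assms in auto)

section \<open>Multiplication in the path algebra\<close>

lemma (in pre_digraph) awlast_append:
  "awlast u (p @ q) = awlast (awlast u p) q"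
  by (induction p arbitrary: u) auto

lemma (in wf_digraph) quiver_paths_Nil_iff [simp]:
  "(u, []) \<in> quiver_paths G \<longleftrightarrow> u \<in> verts G"
  by (auto simp: quiver_paths_def awalk_Nil_iff)

lemma (in wf_digraph) quiver_paths_Cons_iff [simp]:
  "(u, e # p) \<in> quiver_paths G \<longleftrightarrow> e \<in> arcs G \<and> u = tail G e \<and> (head G e, p) \<in> quiver_paths G"
  by (auto simp: quiver_paths_def awalk_Cons_iff)

lemma (in wf_digraph) quiver_paths_vertsD:
  "(u, p) \<in> quiver_paths G \<Longrightarrow> u \<in> verts G"
  by (cases p) auto

lemma (in wf_digraph) quiver_paths_append_iff:
  "(u, p @ q) \<in> quiver_paths G \<longleftrightarrow> (u, p) \<in> quiver_paths G \<and> (awlast u p, q) \<in> quiver_paths G"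
  by (induction p arbitrary: u) (auto dest: quiver_paths_vertsD)

lemma (in wf_digraph) quiver_paths_arcsD:
  "(u, p) \<in> quiver_paths G \<Longrightarrow> set p \<subseteq> arcs G"
  by (induction p arbitrary: u) auto

lemma (in wf_digraph) quiver_paths_awlastD:
  "(u, p) \<in> quiver_paths G \<Longrightarrow> awlast u p \<in> verts G"
  by (induction p arbitrary: u) auto

context pre_digraph
begin

lemma path_algebra_carrier:
  "f \<in> carrier (path_algebra G) \<longleftrightarrow> finite {x. f x \<noteq> 0} \<and> {x. f x \<noteq> 0} \<subseteq> quiver_paths G"
  by (simp add: path_algebra_def)

lemma path_algebra_mult:
  "(f \<otimes>\<^bsub>path_algebra G\<^esub> g) (u, p) = (\<Sum>i\<le>length p. f (u, take i p) * g (awlast u (take i p), drop i p))"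
  by (simp add: path_algebra_def)

lemma path_algebra_add: "f \<oplus>\<^bsub>path_algebra G\<^esub> g = (\<lambda>x. f x + g x)"
  by (simp add: path_algebra_def)

lemma path_algebra_zero: "\<zero>\<^bsub>path_algebra G\<^esub> = (\<lambda>_. 0)"
  by (simp add: path_algebra_def)

lemma path_algebra_one: "\<one>\<^bsub>path_algebra G\<^esub> = (\<lambda>(u, p). if u \<in> verts G \<and> p = [] then 1 else 0)"
  by (simp add: path_algebra_def)

lemma path_algebra_mult_nonzeroE:
  assumes "(f \<otimes>\<^bsub>path_algebra G\<^esub> g) (u, r) \<noteq> 0"
  obtains p q where "r = p @ q" "f (u, p) \<noteq> 0" "g (awlast u p, q) \<noteq> 0"
proof -
  from assms obtain i where "f (u, take i r) * g (awlast u (take i r), drop i r) \<noteq> 0"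
    unfolding path_algebra_mult by (meson sum.not_neutral_contains_not_neutral)
  then show thesis using that[of "take i r" "drop i r"] by simp
qed

text \<open>The convolution sum collapses to the cut after \<open>p\<close>, because the hypothesis
  kills every other cut. It is applied when one factor is a single path or is supported on trivial
  paths.\<close>

lemma path_algebra_mult_append:
  assumes "\<And>p' q'. p @ q = p' @ q' \<Longrightarrow> p' \<noteq> p \<Longrightarrow> f (u, p') = 0 \<or> g (awlast u p', q') = 0"
  shows "(f \<otimes>\<^bsub>path_algebra G\<^esub> g) (u, p @ q) = f (u, p) * g (awlast u p, q)"
proof -
  have "f (u, take i (p @ q)) * g (awlast u (take i (p @ q)), drop i (p @ q)) = 0"
    if "i \<in> {..length (p @ q)} - {length p}" for i
  proof -
    have "length (take i (p @ q)) \<noteq> length p" using that by (auto simp: min_def)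
    then have "take i (p @ q) \<noteq> p" by metis
    then show ?thesis
      using assms[of "take i (p @ q)" "drop i (p @ q)"] append_take_drop_id[of i "p @ q"]
      unfolding mult_eq_0_iff by metis
  qed
  then have "(\<Sum>i\<le>length (p @ q). f (u, take i (p @ q)) * g (awlast u (take i (p @ q)), drop i (p @ q)))
    = (\<Sum>i\<in>{length p}. f (u, take i (p @ q)) * g (awlast u (take i (p @ q)), drop i (p @ q)))"
    by (intro sum.mono_neutral_right) auto
  then show ?thesis by (simp add: path_algebra_mult)
qed

lemma path_algebra_mult_path_elem:
  "(f \<otimes>\<^bsub>path_algebra G\<^esub> path_elem (v, q)) (u, p @ q) = (if awlast u p = v then f (u, p) else 0)"
  by (subst path_algebra_mult_append) (auto simp: path_elem_def)

lemma path_elem_mult_path_elem: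
  "path_elem (u, p) \<otimes>\<^bsub>path_algebra G\<^esub> path_elem (v, q) =
     (if awlast u p = v then path_elem (u, p @ q) else (\<lambda>_. 0) :: 'a \<times> 'b list \<Rightarrow> 'k::field)"
proof
  fix x :: "'a \<times> 'b list"
  obtain w r where x: "x = (w, r)" by force
  show "(path_elem (u, p) \<otimes>\<^bsub>path_algebra G\<^esub> path_elem (v, q)) x =
    (if awlast u p = v then path_elem (u, p @ q) else (\<lambda>_. 0) :: 'a \<times> 'b list \<Rightarrow> 'k) x"
  proof (cases "x = (u, p @ q)")
    case True
    then show ?thesis by (simp add: path_algebra_mult_path_elem) (simp add: path_elem_def)
  next
    case False
    have "(path_elem (u, p) \<otimes>\<^bsub>path_algebra G\<^esub> (path_elem (v, q) :: _ \<Rightarrow> 'k)) x = 0"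
    proof (rule ccontr)
      assume "\<not> ?thesis"
      then obtain p' q' where "r = p' @ q'" "path_elem (u, p) (w, p') \<noteq> (0 :: 'k)"
        "path_elem (v, q) (awlast w p', q') \<noteq> (0 :: 'k)"
        unfolding x by (rule path_algebra_mult_nonzeroE)
      then have "(w, p') = (u, p)" "(awlast w p', q') = (v, q)"
        unfolding path_elem_def by meson+
      then show False using False x \<open>r = p' @ q'\<close> by simp
    qed
    then show ?thesis using False by (simp add: path_elem_def)
  qed
qed

end

section \<open>Scalars in the path algebra\<close>

context wf_digraph
begin

text \<open>The image of \<open>c\<close> under the structure map of the path algebra; the classes
  of these elements modulo \<open>I\<close> make up \<open>base_field\<close>.\<close>

abbreviation scalar :: "'k::field \<Rightarrow> 'a \<times> 'b list \<Rightarrow> 'k" where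
  "scalar c \<equiv> (\<lambda>x. c * \<one>\<^bsub>path_algebra G\<^esub> x)"

lemma scalar_mult:
  fixes f :: "'a \<times> 'b list \<Rightarrow> 'k::field"
  assumes "f \<in> carrier (path_algebra G)"
  shows "scalar c \<otimes>\<^bsub>path_algebra G\<^esub> f = (\<lambda>x. c * f x)"
proof
  fix x :: "'a \<times> 'b list"
  obtain u p where x: "x = (u, p)" by force
  have "(scalar c \<otimes>\<^bsub>path_algebra G\<^esub> f) (u, [] @ p) = scalar c (u, []) * f (awlast u [], p)"
    by (intro path_algebra_mult_append) (auto simp: path_algebra_one)
  \<comment> \<open>\<open>scalar c\<close> takes the value \<open>c\<close> only on trivial paths
    at vertices; if \<open>u\<close> is not a vertex, both sides vanish because \<open>f\<close> is
    supported on paths.\<close>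
  moreover have "u \<in> verts G" if "f (u, p) \<noteq> 0"
    using that assms by (auto simp: path_algebra_carrier intro: quiver_paths_vertsD)
  ultimately show "(scalar c \<otimes>\<^bsub>path_algebra G\<^esub> f) x = c * f x"
    using x by (auto simp: path_algebra_one)
qed

lemma mult_scalar:
  fixes f :: "'a \<times> 'b list \<Rightarrow> 'k::field"
  assumes "f \<in> carrier (path_algebra G)"
  shows "f \<otimes>\<^bsub>path_algebra G\<^esub> scalar c = (\<lambda>x. c * f x)"
proof
  fix x :: "'a \<times> 'b list"
  obtain u p where x: "x = (u, p)" by force
  have "(f \<otimes>\<^bsub>path_algebra G\<^esub> scalar c) (u, p @ []) = f (u, p) * scalar c (awlast u p, [])"
    by (intro path_algebra_mult_append) (auto simp: path_algebra_one)
  moreover have "awlast u p \<in> verts G" if "f (u, p) \<noteq> 0"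
    using that assms by (auto simp: path_algebra_carrier intro: quiver_paths_awlastD)
  ultimately show "(f \<otimes>\<^bsub>path_algebra G\<^esub> scalar c) x = c * f x"
    using x by (auto simp: path_algebra_one)
qed

lemma path_elem_carrier: "path_elem x \<in> carrier (path_algebra G) \<longleftrightarrow> x \<in> quiver_paths G"
  by (auto simp: path_algebra_carrier path_elem_def)

end

text \<open>The identity is the sum of the trivial paths, so its support is finite because there are
  finitely many vertices.\<close>

lemma (in fin_digraph) scalar_carrier: "scalar c \<in> carrier (path_algebra G)"
proof -
  have "{x. scalar c x \<noteq> 0} \<subseteq> (\<lambda>u. (u, [])) ` verts G"
    by (auto simp: path_algebra_one split: if_splits)
  moreover have "\<dots> \<subseteq> quiver_paths G" by auto
  ultimately show ?thesis
    using finite_verts unfolding path_algebra_carrier by (meson finite_imageI finite_subset order_trans)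
qed

section \<open>Quadratic monomial ideals\<close>

text \<open>
  Admissibility includes that \<^const>\<open>path_algebra\<close> is a ring, because \<^const>\<open>ideal\<close> does.
\<close>

locale quadratic_monomial = fin_digraph G for G :: "('v, 'e) pre_digraph" +
  fixes I :: "('v \<times> 'e list \<Rightarrow> 'k::field) set" and S :: "('v \<times> 'e list) set"
  assumes admissible: "admissible_ideal G I"
    and S_subset: "S \<subseteq> {x \<in> quiver_paths G. length (snd x) = 2}"
    and I_eq: "I = Idl\<^bsub>path_algebra G\<^esub> (path_elem ` S)"
begin

abbreviation PA :: "('v \<times> 'e list \<Rightarrow> 'k) ring" where "PA \<equiv> path_algebra G"
abbreviation QA :: "('v \<times> 'e list \<Rightarrow> 'k) set ring" where "QA \<equiv> quiver_algebra G I"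
abbreviation cls :: "('v \<times> 'e list \<Rightarrow> 'k) \<Rightarrow> ('v \<times> 'e list \<Rightarrow> 'k) set" where
  "cls f \<equiv> I +>\<^bsub>PA\<^esub> f"

lemma ideal_I: "ideal I PA"
  using admissible by (simp add: admissible_ideal_def)

sublocale P: ideal I PA
  by (rule ideal_I)

sublocale Q: ring QA
  by (rule P.quotient_is_ring)

text \<open>The condition that \<open>ab\<close> is not in \<open>I\<close>, read off from the
  generators alone; \<open>follows_iff\<close> proves the equivalence.\<close>

definition follows :: "'e \<Rightarrow> 'e \<Rightarrow> bool" where
  "follows a b \<longleftrightarrow> a \<in> arcs G \<and> b \<in> arcs G \<and> head G a = tail G b \<and> (tail G a, [a, b]) \<notin> S"

text \<open>A combinatorial description by the generators, identified in
  \<open>path_elem_mem_I_iff\<close> with the paths outside \<open>I\<close>.\<close>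

definition nonzero_paths :: "('v \<times> 'e list) set" where
  "nonzero_paths = {x \<in> quiver_paths G. successively follows (snd x)}"

lemma nonzero_pathsD: "x \<in> nonzero_paths \<Longrightarrow> x \<in> quiver_paths G"
  by (simp add: nonzero_paths_def)

lemma nonzero_paths_appendD:
  assumes "(u, p @ q) \<in> nonzero_paths"
  shows "(u, p) \<in> nonzero_paths" "(awlast u p, q) \<in> nonzero_paths"
  using assms by (auto simp: nonzero_paths_def quiver_paths_append_iff successively_append_iff)

text \<open>Since \<open>follows\<close> includes composability, a nonempty chain of arrows is
  automatically a path, with the tail of its first arrow as source. This translates nontrivial
  nonzero paths into chains.\<close>

lemma nonzero_paths_alt:
  "(u, p) \<in> nonzero_paths \<longleftrightarrow>
     (if p = [] then u \<in> verts G
      else u = tail G (hd p) \<and> set p \<subseteq> arcs G \<and> successively follows p)"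
proof -
  have "(u, p) \<in> quiver_paths G"
    if "p \<noteq> []" "u = tail G (hd p)" "set p \<subseteq> arcs G" "successively follows p"
    using that
  proof (induction p arbitrary: u)
    case (Cons a p)
    then show ?case by (cases "p = []") (auto simp: successively_Cons follows_def)
  qed simp
  moreover have "u = tail G (hd p)" if "(u, p) \<in> quiver_paths G" "p \<noteq> []"
    using that by (cases p) auto
  ultimately show ?thesis
    by (auto simp: nonzero_paths_def dest: quiver_paths_arcsD)
qed

section \<open>The ideal \<open>I\<close> in terms of coefficients\<close>

lemma uminus_eq:
  assumes "f \<in> carrier PA"
  shows "\<ominus>\<^bsub>PA\<^esub> f = (\<lambda>x. - f x)"
proof (rule P.minus_equality)
  show "(\<lambda>x. - f x) \<oplus>\<^bsub>PA\<^esub> f = \<zero>\<^bsub>PA\<^esub>"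
    by (simp add: path_algebra_add path_algebra_zero)
qed (use assms in \<open>simp_all add: path_algebra_carrier\<close>)

lemma minus_eq: "g \<in> carrier PA \<Longrightarrow> f \<ominus>\<^bsub>PA\<^esub> g = (\<lambda>x. f x - g x)"
  by (simp add: a_minus_def path_algebra_add uminus_eq)

lemma carrier_restrict:
  assumes "f \<in> carrier PA" "\<And>x. g x \<noteq> 0 \<Longrightarrow> f x \<noteq> 0"
  shows "g \<in> carrier PA"
proof -
  have "{x. g x \<noteq> 0} \<subseteq> {x. f x \<noteq> 0}" using assms(2) by blast
  then show ?thesis using assms(1) by (auto simp: path_algebra_carrier intro: finite_subset)
qed

lemma carrier_add:
  "f \<in> carrier PA \<Longrightarrow> g \<in> carrier PA \<Longrightarrow> (\<lambda>x. f x + g x) \<in> carrier PA"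
  using P.add.m_closed[of f g] by (simp add: path_algebra_add)

text \<open>If a product has a nonzero coefficient at a path \<open>r\<close>, then some prefix of
  \<open>r\<close> and the complementary suffix have nonzero coefficients in the two factors; both
  are nonzero paths whenever \<open>r\<close> is.\<close>

lemma ideal_of_vanishing:
  "ideal {f \<in> carrier PA. \<forall>x\<in>nonzero_paths. f x = 0} PA" (is "ideal ?J _")
proof (rule idealI)
  show "ring PA" by (rule P.ring_axioms)
  show "subgroup ?J (add_monoid PA)"
  proof (rule P.add.subgroupI)
    show "?J \<noteq> {}" using P.zero_closed by (auto simp: path_algebra_zero)
    fix f assume f: "f \<in> ?J"
    then show "\<ominus>\<^bsub>PA\<^esub> f \<in> ?J" by (auto simp: uminus_eq path_algebra_carrier)
    fix g assume "g \<in> ?J"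
    with f show "f \<oplus>\<^bsub>PA\<^esub> g \<in> ?J" using P.add.m_closed[of f g] by (auto simp: path_algebra_add)
  qed auto
  fix f g assume f: "f \<in> ?J" and g: "g \<in> carrier PA"
  have "(g \<otimes>\<^bsub>PA\<^esub> f) (u, r) = 0" if "(u, r) \<in> nonzero_paths" for u r
  proof (rule ccontr)
    assume "(g \<otimes>\<^bsub>PA\<^esub> f) (u, r) \<noteq> 0"
    then obtain p q where "r = p @ q" "g (u, p) \<noteq> 0" "f (awlast u p, q) \<noteq> 0"
      by (rule path_algebra_mult_nonzeroE)
    then show False using f nonzero_paths_appendD(2) that by blast
  qed
  then show "g \<otimes>\<^bsub>PA\<^esub> f \<in> ?J" using f g P.m_closed[of g f] by auto
  have "(f \<otimes>\<^bsub>PA\<^esub> g) (u, r) = 0" if "(u, r) \<in> nonzero_paths" for u r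
  proof (rule ccontr)
    assume "(f \<otimes>\<^bsub>PA\<^esub> g) (u, r) \<noteq> 0"
    then obtain p q where "r = p @ q" "f (u, p) \<noteq> 0" "g (awlast u p, q) \<noteq> 0"
      by (rule path_algebra_mult_nonzeroE)
    then show False using f nonzero_paths_appendD(1) that by blast
  qed
  then show "f \<otimes>\<^bsub>PA\<^esub> g \<in> ?J" using f g P.m_closed[of f g] by auto
qed

text \<open>Consecutive arrows of a path are composable, so \<open>follows\<close> can fail between
  them only if their product is in \<open>S\<close>. Multiplying this generator by the rest of the
  path on both sides stays in \<open>I\<close>.\<close>

lemma zero_path_in_I:
  assumes "x \<in> quiver_paths G" "x \<notin> nonzero_paths"
  shows "path_elem x \<in> I"
proof -
  obtain u p where x: "x = (u, p)" by force
  with assms have "\<not> successively follows p" by (auto simp: nonzero_paths_def)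
  then obtain xs a b ys where p: "p = xs @ a # b # ys" "\<not> follows a b" by (rule not_successivelyE)
  then have path: "(u, xs @ [a, b] @ ys) \<in> quiver_paths G" using assms x by simp
  then have w: "(u, xs) \<in> quiver_paths G" "awlast u xs = tail G a" "head G a = tail G b"
      "a \<in> arcs G" "b \<in> arcs G" "(head G b, ys) \<in> quiver_paths G"
    by (auto simp: quiver_paths_append_iff)
  then have "(tail G a, [a, b]) \<in> S" using p by (simp add: follows_def)
  moreover have "path_elem ` S \<subseteq> carrier PA"
    using S_subset by (auto simp: path_elem_carrier)
  ultimately have "path_elem (tail G a, [a, b]) \<in> I"
    using P.genideal_self[of "path_elem ` S"] unfolding I_eq by auto
  then have "(path_elem (u, xs) \<otimes>\<^bsub>PA\<^esub> path_elem (tail G a, [a, b])) \<otimes>\<^bsub>PA\<^esub> path_elem (head G b, ys) \<in> I"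
    using w by (intro P.I_r_closed P.I_l_closed) (simp_all add: path_elem_carrier)
  then show ?thesis
    using w by (simp add: path_elem_mult_path_elem awlast_append x p)
qed

text \<open>The elements vanishing on the nonzero paths form an ideal that contains the generators,
  hence \<open>I\<close>. Conversely, such an element is a finite sum of scalar multiples of paths
  that lie in \<open>I\<close>.\<close>

lemma mem_I_iff: "f \<in> I \<longleftrightarrow> f \<in> carrier PA \<and> (\<forall>x\<in>nonzero_paths. f x = 0)"
proof
  let ?J = "{f \<in> carrier PA. \<forall>x\<in>nonzero_paths. f x = 0}"
  have "(0 :: 'k) = path_elem s x" if s': "s \<in> S" and x: "x \<in> nonzero_paths" for s x
  proof -
    obtain u a b where s: "s = (u, [a, b])"
      using subsetD[OF S_subset s'] by (cases s) (auto simp: numeral_2_eq_2 length_Suc_conv)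
    then have "u = tail G a" using s' S_subset by auto
    then have "s \<notin> nonzero_paths" using s' s by (auto simp: nonzero_paths_def follows_def)
    then show ?thesis using x by (auto simp: path_elem_def)
  qed
  then have "path_elem ` S \<subseteq> ?J" using S_subset by (fastforce simp: path_elem_carrier)
  then have "I \<subseteq> ?J" unfolding I_eq by (intro P.genideal_minimal ideal_of_vanishing)
  then show "f \<in> I \<Longrightarrow> f \<in> carrier PA \<and> (\<forall>x\<in>nonzero_paths. f x = 0)" by blast
next
  have "\<forall>f\<in>carrier PA. {x. f x \<noteq> 0} \<subseteq> T \<longrightarrow> f \<in> I"
    if "finite T" "T \<subseteq> quiver_paths G - nonzero_paths" for T
    using that
  proof (induction T rule: finite_induct)
    case empty
    have "(\<lambda>_. 0) \<in> I"
      using additive_subgroup.zero_closed[OF ideal.axioms(1)[OF ideal_I]] by (simp add: path_algebra_zero)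
    moreover have "f = (\<lambda>_. 0)" if "{x. f x \<noteq> 0} \<subseteq> {}" for f :: "'v \<times> 'e list \<Rightarrow> 'k"
      using that by blast
    ultimately show ?case by metis
  next
    case (insert x T)
    show ?case
    proof (intro ballI impI)
      fix f assume f: "f \<in> carrier PA" "{y. f y \<noteq> 0} \<subseteq> insert x T"
      \<comment> \<open>\<open>f\<close> is the sum of \<open>f(x := 0)\<close>, covered by the
        induction hypothesis, and the multiple by \<open>f x\<close> of the path \<open>x\<close> in
        \<open>I\<close>.\<close>
      have "f(x := 0) \<in> carrier PA"
        using f(1) by (rule carrier_restrict) (auto split: if_splits)
      moreover have "{y. (f(x := 0)) y \<noteq> 0} \<subseteq> T"
        using f(2) by (auto split: if_splits)
      ultimately have "f(x := 0) \<in> I"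
        using insert.IH insert.prems by blast
      moreover have "scalar (f x) \<otimes>\<^bsub>PA\<^esub> path_elem x \<in> I"
        using zero_path_in_I[of x] insert.prems scalar_carrier by (intro P.I_l_closed) auto
      ultimately have "f(x := 0) \<oplus>\<^bsub>PA\<^esub> (scalar (f x) \<otimes>\<^bsub>PA\<^esub> path_elem x) \<in> I"
        using additive_subgroup.a_closed[OF ideal.axioms(1)[OF ideal_I]] by blast
      also have "f(x := 0) \<oplus>\<^bsub>PA\<^esub> (scalar (f x) \<otimes>\<^bsub>PA\<^esub> path_elem x) = f"
        using insert.prems
        by (auto simp: path_elem_carrier scalar_mult path_algebra_add) (auto simp: path_elem_def)
      finally show "f \<in> I" .
    qed
  qed
  note * = this[of "{x. f x \<noteq> 0}"]
  assume f: "f \<in> carrier PA \<and> (\<forall>x\<in>nonzero_paths. f x = 0)"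
  then have "finite {x. f x \<noteq> 0}" "{x. f x \<noteq> 0} \<subseteq> quiver_paths G - nonzero_paths"
    by (auto simp: path_algebra_carrier)
  from *[OF this] f show "f \<in> I" by blast
qed

section \<open>Classes modulo \<open>I\<close>, spans of paths and their dimension\<close>

lemma cls_eq_iff:
  assumes "f \<in> carrier PA" "g \<in> carrier PA"
  shows "cls f = cls g \<longleftrightarrow> (\<forall>x\<in>nonzero_paths. f x = g x)"
proof -
  have "cls f = cls g \<longleftrightarrow> f \<ominus>\<^bsub>PA\<^esub> g \<in> I"
    using P.quotient_eq_iff_same_a_r_cos[OF ideal_I] assms by blast
  also have "\<dots> \<longleftrightarrow> (\<forall>x\<in>nonzero_paths. f x = g x)"
    using assms P.minus_closed[OF assms] by (simp add: mem_I_iff minus_eq)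
  finally show ?thesis .
qed

lemma cls_mult: "f \<in> carrier PA \<Longrightarrow> g \<in> carrier PA \<Longrightarrow> cls f \<otimes>\<^bsub>QA\<^esub> cls g = cls (f \<otimes>\<^bsub>PA\<^esub> g)"
  by (simp add: FactRing_def P.rcoset_mult_add)

lemma cls_add: "f \<in> carrier PA \<Longrightarrow> g \<in> carrier PA \<Longrightarrow> cls f \<oplus>\<^bsub>QA\<^esub> cls g = cls (\<lambda>x. f x + g x)"
  by (simp add: FactRing_def P.a_rcos_sum path_algebra_add[symmetric])

lemma carrier_QA: "carrier QA = cls ` carrier PA"
  by (auto simp: FactRing_def A_RCOSETS_defs a_r_coset_def)

lemma cls_carrier: "f \<in> carrier PA \<Longrightarrow> cls f \<in> carrier QA"
  by (simp add: carrier_QA)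

lemma zero_carrier: "(\<lambda>_. 0) \<in> carrier PA"
  using P.zero_closed by (simp add: path_algebra_zero)

lemma zero_mem_I: "(\<lambda>_. 0) \<in> I"
  by (simp add: mem_I_iff zero_carrier)

lemma zero_QA: "\<zero>\<^bsub>QA\<^esub> = cls (\<lambda>_. 0)"
  using P.a_rcos_zero[OF ideal_I zero_mem_I] by (simp add: FactRing_def)

lemma cls_minus:
  assumes f: "f \<in> carrier PA"
  shows "\<ominus>\<^bsub>QA\<^esub> cls f = cls (\<lambda>x. - f x)"
proof -
  have minus: "(\<lambda>x. - f x) \<in> carrier PA" using f by (rule carrier_restrict) auto
  then have "cls (\<lambda>x. - f x) \<oplus>\<^bsub>QA\<^esub> cls f = \<zero>\<^bsub>QA\<^esub>"
    using f by (simp add: cls_add zero_QA)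
  then show ?thesis using f minus by (intro Q.minus_equality cls_carrier)
qed

text \<open>The \<open>K\<close>-span of the classes of the nonzero paths in \<open>T\<close>,
  expressed by coefficients of representatives; at paths in \<open>I\<close> a representative may
  have arbitrary coefficients.\<close>

definition path_span :: "('v \<times> 'e list) set \<Rightarrow> ('v \<times> 'e list \<Rightarrow> 'k) set set" where
  "path_span T = {cls f |f. f \<in> carrier PA \<and> (\<forall>x\<in>nonzero_paths - T. f x = 0)}"

lemma cls_in_path_span_iff:
  assumes "f \<in> carrier PA"
  shows "cls f \<in> path_span T \<longleftrightarrow> (\<forall>x\<in>nonzero_paths - T. f x = 0)"
proof
  assume "cls f \<in> path_span T"
  then obtain g where "g \<in> carrier PA" "cls f = cls g" "\<forall>x\<in>nonzero_paths - T. g x = 0"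
    by (auto simp: path_span_def)
  then show "\<forall>x\<in>nonzero_paths - T. f x = 0" using cls_eq_iff[OF assms] by auto
qed (use assms in \<open>auto simp: path_span_def\<close>)

lemma path_spanE:
  assumes "v \<in> path_span T"
  obtains f where "f \<in> carrier PA" "v = cls f" "\<And>x. x \<in> nonzero_paths - T \<Longrightarrow> f x = 0"
  using assms by (auto simp: path_span_def)

lemma path_span_mono: "T \<subseteq> T' \<Longrightarrow> path_span T \<subseteq> path_span T'"
  by (auto simp: path_span_def)

lemma path_span_empty: "path_span {} = {\<zero>\<^bsub>QA\<^esub>}"
proof
  show "path_span {} \<subseteq> {\<zero>\<^bsub>QA\<^esub>}"
  proof
    fix v assume "v \<in> path_span {}"
    then obtain f where "f \<in> carrier PA" "v = cls f" "\<And>x. x \<in> nonzero_paths - {} \<Longrightarrow> f x = 0"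
      by (rule path_spanE) blast
    then show "v \<in> {\<zero>\<^bsub>QA\<^esub>}" using cls_eq_iff[OF _ zero_carrier, of f] by (simp add: zero_QA)
  qed
  show "{\<zero>\<^bsub>QA\<^esub>} \<subseteq> path_span {}"
    by (simp add: zero_QA cls_in_path_span_iff zero_carrier)
qed

lemma path_span_nonzero_paths: "path_span nonzero_paths = carrier QA"
  by (auto simp: path_span_def carrier_QA)

text \<open>Adding a path \<open>x\<close> to \<open>T\<close> is a line extension by the class of
  \<open>x\<close>, which is outside the old span because its coefficient at \<open>x\<close> is 1.
  Each such extension raises the dimension by one.\<close>

lemma dimension_path_span:
  assumes "finite T" "T \<subseteq> nonzero_paths"
  shows "ring.dimension QA (card T) (base_field G I) (path_span T)"
  using assms
proof (induction T rule: finite_induct)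
  case empty
  then show ?case using Q.zero_dim by (simp add: path_span_empty)
next
  case (insert x T)
  have x: "path_elem x \<in> carrier PA"
    using insert.prems by (auto simp: path_elem_carrier intro: nonzero_pathsD)
  have "cls (path_elem x) \<notin> path_span T"
    using insert.prems insert.hyps x by (auto simp: cls_in_path_span_iff path_elem_def)
  then have "ring.dimension QA (Suc (card T)) (base_field G I)
      (ring.line_extension QA (base_field G I) (cls (path_elem x)) (path_span T))"
    using insert x by (intro Q.Suc_dim cls_carrier) auto
  also have "ring.line_extension QA (base_field G I) (cls (path_elem x)) (path_span T)
    = path_span (insert x T)"
  proof (intro subset_antisym subsetI)
    fix v assume "v \<in> ring.line_extension QA (base_field G I) (cls (path_elem x)) (path_span T)"
    then obtain k w where k: "k \<in> base_field G I" and w: "w \<in> path_span T"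
      and v: "v = k \<otimes>\<^bsub>QA\<^esub> cls (path_elem x) \<oplus>\<^bsub>QA\<^esub> w"
      by (auto simp: Q.line_extension_mem_iff)
    from k obtain c where c: "k = cls (scalar c)" by (auto simp: base_field_def)
    from w obtain g where g: "g \<in> carrier PA" "w = cls g" "\<And>y. y \<in> nonzero_paths - T \<Longrightarrow> g y = 0"
      by (rule path_spanE) blast
    have cx: "(\<lambda>y. c * path_elem x y) \<in> carrier PA" using x by (rule carrier_restrict) auto
    have "v = cls (\<lambda>y. c * path_elem x y + g y)"
      using x g cx by (simp add: v c cls_mult scalar_carrier scalar_mult cls_add)
    moreover have "cls (\<lambda>y. c * path_elem x y + g y) \<in> path_span (insert x T)"
      using carrier_add[OF cx g(1)] g(3)
      by (subst cls_in_path_span_iff) (auto simp: path_elem_def)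
    ultimately show "v \<in> path_span (insert x T)" by simp
  next
    fix v assume "v \<in> path_span (insert x T)"
    then obtain f where f: "f \<in> carrier PA" "v = cls f" "\<And>y. y \<in> nonzero_paths - insert x T \<Longrightarrow> f y = 0"
      by (rule path_spanE) blast
    have cx: "(\<lambda>y. f x * path_elem x y) \<in> carrier PA" using x by (rule carrier_restrict) auto
    have f0: "f(x := 0) \<in> carrier PA"
      using f(1) by (rule carrier_restrict) (auto split: if_splits)
    \<comment> \<open>The coefficient at \<open>x\<close> becomes the scalar of the line extension,
      and the rest of \<open>f\<close> represents an element of the old span.\<close>
    have "(\<lambda>y. f x * path_elem x y + (f(x := 0)) y) = f" by (auto simp: path_elem_def)
    then have "v = cls (scalar (f x)) \<otimes>\<^bsub>QA\<^esub> cls (path_elem x) \<oplus>\<^bsub>QA\<^esub> cls (f(x := 0))"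
      using x cx f0 f(2) by (simp add: cls_mult scalar_carrier scalar_mult cls_add)
    moreover have "cls (f(x := 0)) \<in> path_span T"
      using f0 f(3) by (subst cls_in_path_span_iff) auto
    moreover have base: "cls (scalar (f x)) \<in> base_field G I"
      unfolding base_field_def by (rule rangeI)
    ultimately show "v \<in> ring.line_extension QA (base_field G I) (cls (path_elem x)) (path_span T)"
      using base unfolding Q.line_extension_mem_iff by blast
  qed
  finally show ?case using insert.hyps by simp
qed

section \<open>Nonzero products of arrows and finiteness of the set of nonzero paths\<close>

lemma path_elem_mem_I_iff:
  "x \<in> quiver_paths G \<Longrightarrow> path_elem x \<in> I \<longleftrightarrow> x \<notin> nonzero_paths"
  by (auto simp: mem_I_iff path_elem_carrier) (auto simp: path_elem_def)

lemma arrow_elem_mult_path_elem: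
  "arrow_elem G a \<otimes>\<^bsub>PA\<^esub> path_elem (u, p) =
     (if head G a = u then path_elem (tail G a, a # p) else (\<lambda>_. 0))"
  by (simp add: arrow_elem_def path_elem_mult_path_elem)

lemma path_elem_mult_arrow_elem:
  "path_elem (u, p) \<otimes>\<^bsub>PA\<^esub> arrow_elem G a =
     (if awlast u p = tail G a then path_elem (u, p @ [a]) else (\<lambda>_. 0))"
  by (simp add: arrow_elem_def path_elem_mult_path_elem)

lemma arrow_elem_carrier: "a \<in> arcs G \<Longrightarrow> arrow_elem G a \<in> carrier PA"
  by (simp add: arrow_elem_def path_elem_carrier)

text \<open>Through this equivalence (S1) becomes left and right uniqueness of
  \<open>follows\<close>. For arrows that are not composable the product is zero and lies in
  \<open>I\<close>, while \<open>follows\<close> fails by definition.\<close>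

lemma follows_iff:
  assumes "a \<in> arcs G" "b \<in> arcs G"
  shows "follows a b \<longleftrightarrow> arrow_elem G a \<otimes>\<^bsub>PA\<^esub> arrow_elem G b \<notin> I"
proof (cases "head G a = tail G b")
  case True
  then have "(tail G a, [a, b]) \<in> quiver_paths G" using assms by simp
  with True show ?thesis
    using assms path_elem_mem_I_iff[of "(tail G a, [a, b])"]
    by (simp add: arrow_elem_mult_path_elem arrow_elem_def[of G b] nonzero_paths_alt)
next
  case False
  then show ?thesis
    by (simp add: arrow_elem_mult_path_elem arrow_elem_def[of G b] zero_mem_I follows_def)
qed

lemma path_elem_in_arrow_ideal_power:
  assumes "(u, p) \<in> quiver_paths G"
  shows "path_elem (u, p) \<in> arrow_ideal G [^]\<^bsub>ideals_set PA\<^esub> length p"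
  using assms
proof (induction p rule: rev_induct)
  case Nil
  \<comment> \<open>The zeroth power is the unit of the monoid of ideals, namely the whole path
    algebra.\<close>
  then show ?case by (simp add: nat_pow_def ideals_set_def path_elem_carrier)
next
  case (snoc a p)
  then have a: "a \<in> arcs G" "(u, p) \<in> quiver_paths G" "awlast u p = tail G a"
    by (auto simp: quiver_paths_append_iff)
  have "arrow_elem G ` arcs G \<subseteq> carrier PA" using arrow_elem_carrier by auto
  then have "arrow_elem G a \<in> (arrow_ideal G :: ('v \<times> 'e list \<Rightarrow> 'k) set)"
    using P.genideal_self a(1) unfolding arrow_ideal_def by blast
  then have "path_elem (u, p) \<otimes>\<^bsub>PA\<^esub> arrow_elem G a \<in>
      ideal_prod PA (arrow_ideal G [^]\<^bsub>ideals_set PA\<^esub> length p) (arrow_ideal G)"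
    using snoc.IH a by (intro ideal_prod.prod) auto
  then show ?case
    using a by (simp add: path_elem_mult_arrow_elem nat_pow_def ideals_set_def)
qed

text \<open>Admissibility puts some power \<open>N\<close> of the arrow ideal into \<open>I\<close>.
  A nonzero path of length at least \<open>N\<close> would have an initial segment of length
  \<open>N\<close>, which lies in that power and yet is a nonzero path.\<close>

lemma nonzero_paths_length_bound:
  "\<exists>N. \<forall>x\<in>nonzero_paths. length (snd x) < N"
proof -
  obtain N :: nat where N: "2 \<le> N" "arrow_ideal G [^]\<^bsub>ideals_set PA\<^esub> N \<subseteq> I"
    using admissible by (auto simp: admissible_ideal_def)
  have "length p < N" if "(u, p) \<in> nonzero_paths" for u p
  proof (rule ccontr)
    assume len: "\<not> length p < N"
    have "(u, take N p) \<in> nonzero_paths"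
      using nonzero_paths_appendD(1)[of u "take N p" "drop N p"] that by simp
    then show False
      using path_elem_in_arrow_ideal_power[of u "take N p"] N len path_elem_mem_I_iff[of "(u, take N p)"]
      by (auto dest: nonzero_pathsD)
  qed
  with N show ?thesis by (intro exI[of _ N]) auto
qed

lemma finite_nonzero_paths: "finite nonzero_paths"
proof -
  obtain N where N: "\<forall>x\<in>nonzero_paths. length (snd x) < N"
    using nonzero_paths_length_bound by blast
  have "x \<in> verts G \<times> {p. set p \<subseteq> arcs G \<and> length p \<le> N}" if "x \<in> nonzero_paths" for x
    using nonzero_pathsD[OF that] bspec[OF N that] quiver_paths_vertsD[of "fst x" "snd x"]
      quiver_paths_arcsD[of "fst x" "snd x"] by (simp add: mem_Times_iff)
  then have "nonzero_paths \<subseteq> verts G \<times> {p. set p \<subseteq> arcs G \<and> length p \<le> N}" by blast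
  then show ?thesis
    by (rule finite_subset) (simp add: finite_lists_length_le)
qed

section \<open>Right submodules of the quotient algebra\<close>

lemma right_submodule_closed:
  assumes "right_submodule QA N"
  shows "\<zero>\<^bsub>QA\<^esub> \<in> N"
    and "v \<in> N \<Longrightarrow> w \<in> N \<Longrightarrow> v \<oplus>\<^bsub>QA\<^esub> w \<in> N"
    and "N \<subseteq> carrier QA"
    and "v \<in> N \<Longrightarrow> w \<in> carrier QA \<Longrightarrow> v \<otimes>\<^bsub>QA\<^esub> w \<in> N"
  using assms unfolding right_submodule_def
  by (auto intro: additive_subgroup.zero_closed additive_subgroup.a_closed
      dest: additive_subgroup.a_Hcarr)

text \<open>Scaling by \<open>c\<close> is right multiplication by the class of
  \<open>scalar c\<close>, so right submodules are subspaces over \<open>K\<close>.\<close>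

lemma right_submodule_scale:
  assumes "right_submodule QA N" "f \<in> carrier PA" "cls f \<in> N"
  shows "cls (\<lambda>x. c * f x) \<in> N"
  using right_submodule_closed(4)[OF assms(1,3) cls_carrier[OF scalar_carrier[of c]]] assms(2)
  by (simp add: cls_mult scalar_carrier mult_scalar)

lemma path_span_subset_right_submodule:
  assumes "right_submodule QA N" "finite T" "T \<subseteq> nonzero_paths"
    and "\<And>x. x \<in> T \<Longrightarrow> cls (path_elem x) \<in> N"
  shows "path_span T \<subseteq> N"
  using assms(2-)
proof (induction T rule: finite_induct)
  case empty
  then show ?case using right_submodule_closed[OF assms(1)] by (simp add: path_span_empty)
next
  case (insert x T)
  show ?case
  proof
    fix v assume "v \<in> path_span (insert x T)"
    then obtain f where f: "f \<in> carrier PA" "v = cls f" "\<And>y. y \<in> nonzero_paths - insert x T \<Longrightarrow> f y = 0"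
      by (rule path_spanE) blast
    have x: "path_elem x \<in> carrier PA"
      using insert.prems by (auto simp: path_elem_carrier intro: nonzero_pathsD)
    have cx: "(\<lambda>y. f x * path_elem x y) \<in> carrier PA" using x by (rule carrier_restrict) auto
    have f0: "f(x := 0) \<in> carrier PA"
      using f(1) by (rule carrier_restrict) (auto split: if_splits)
    have "(\<lambda>y. f x * path_elem x y + (f(x := 0)) y) = f" by (auto simp: path_elem_def)
    then have "v = cls (\<lambda>y. f x * path_elem x y) \<oplus>\<^bsub>QA\<^esub> cls (f(x := 0))"
      using cx f0 f(2) by (simp add: cls_add)
    moreover have "cls (f(x := 0)) \<in> path_span T"
      using f0 f(3) by (subst cls_in_path_span_iff) auto
    ultimately show "v \<in> N"
      using insert right_submodule_closed(2)[OF assms(1)] right_submodule_scale[OF assms(1) x, of "f x"]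
      by blast
  qed
qed

text \<open>A nonzero coefficient of a product at \<open>r\<close> requires a prefix of
  \<open>r\<close> in the support of the left factor. For a nonzero path \<open>r\<close> this
  prefix lies in \<open>T\<close>, and then so does \<open>r\<close> by the closure
  hypothesis.\<close>

lemma right_submodule_path_span:
  assumes "\<And>u p q. (u, p) \<in> T \<Longrightarrow> (u, p @ q) \<in> nonzero_paths \<Longrightarrow> (u, p @ q) \<in> T"
  shows "right_submodule QA (path_span T)"
  unfolding right_submodule_def
proof (intro conjI ballI additive_subgroupI Q.add.subgroupI)
  show "path_span T \<subseteq> carrier QA" using cls_carrier by (auto simp: path_span_def)
  show "path_span T \<noteq> {}" using zero_carrier by (auto simp: path_span_def)
  fix v assume "v \<in> path_span T"
  then obtain f where f: "f \<in> carrier PA" "v = cls f" "\<And>y. y \<in> nonzero_paths - T \<Longrightarrow> f y = 0"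
    by (rule path_spanE) blast
  have "(\<lambda>x. - f x) \<in> carrier PA" using f(1) by (rule carrier_restrict) auto
  then show "\<ominus>\<^bsub>QA\<^esub> v \<in> path_span T"
    using f by (simp add: cls_minus cls_in_path_span_iff)
  fix w assume "w \<in> carrier QA"
  then obtain g where g: "g \<in> carrier PA" "w = cls g" by (auto simp: carrier_QA)
  have "(f \<otimes>\<^bsub>PA\<^esub> g) (u, r) = 0" if "(u, r) \<in> nonzero_paths - T" for u r
  proof (rule ccontr)
    assume "(f \<otimes>\<^bsub>PA\<^esub> g) (u, r) \<noteq> 0"
    then obtain p q where "r = p @ q" "f (u, p) \<noteq> 0" by (rule path_algebra_mult_nonzeroE)
    then show False using that f(3)[of "(u, p)"] assms[of u p q] nonzero_paths_appendD(1)[of u p q]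
      by auto
  qed
  then show "v \<otimes>\<^bsub>QA\<^esub> w \<in> path_span T"
    using f g by (auto simp: cls_mult cls_in_path_span_iff)
next
  fix v w assume "v \<in> path_span T" "w \<in> path_span T"
  then obtain f g where "f \<in> carrier PA" "v = cls f" "\<And>y. y \<in> nonzero_paths - T \<Longrightarrow> f y = 0"
    and "g \<in> carrier PA" "w = cls g" "\<And>y. y \<in> nonzero_paths - T \<Longrightarrow> g y = 0"
    by (metis path_spanE)
  then show "v \<oplus>\<^bsub>QA\<^esub> w \<in> path_span T"
    using carrier_add[of f g] by (simp add: cls_add cls_in_path_span_iff)
qed

end

section \<open>Almost gentle presentations\<close>

locale almost_gentle_presentation = quadratic_monomial G I S
  for G :: "('v, 'e) pre_digraph" and I :: "('v \<times> 'e list \<Rightarrow> 'k::field) set" and S +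
  assumes almost_gentle: "almost_gentle G I"
begin

sublocale C: partial_injection "arcs G" follows
proof
  fix a b b' assume f: "follows a b" "follows a b'"
  then have arcs: "a \<in> arcs G" "b \<in> arcs G" "b' \<in> arcs G" by (auto simp: follows_def)
  then have "\<exists>\<^sub>\<le>\<^sub>1b. b \<in> arcs G \<and> arrow_elem G a \<otimes>\<^bsub>PA\<^esub> arrow_elem G b \<notin> I"
    using almost_gentle by (simp add: almost_gentle_def)
  then show "b = b'"
    by (rule Uniq_D) (use f arcs follows_iff in auto)
next
  fix a a' b assume f: "follows a b" "follows a' b"
  then have arcs: "a \<in> arcs G" "a' \<in> arcs G" "b \<in> arcs G" by (auto simp: follows_def)
  then have "\<exists>\<^sub>\<le>\<^sub>1a. a \<in> arcs G \<and> arrow_elem G a \<otimes>\<^bsub>PA\<^esub> arrow_elem G b \<notin> I"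
    using almost_gentle by (simp add: almost_gentle_def)
  then show "a = a'"
    by (rule Uniq_D) (use f arcs follows_iff in auto)
next
  \<comment> \<open>\<open>[]\<close> is added separately because it comes from a nonzero path only
    if the quiver has a vertex.\<close>
  have "{p. set p \<subseteq> arcs G \<and> successively follows p} \<subseteq> insert [] (snd ` nonzero_paths)"
  proof
    fix p assume "p \<in> {p. set p \<subseteq> arcs G \<and> successively follows p}"
    then have "p = [] \<or> (tail G (hd p), p) \<in> nonzero_paths" by (auto simp: nonzero_paths_alt)
    then show "p \<in> insert [] (snd ` nonzero_paths)" by force
  qed
  then show "finite {p. set p \<subseteq> arcs G \<and> successively follows p}"
    using finite_nonzero_paths by (auto intro: finite_subset)
qed

section \<open>Counting the nonzero paths and identifying the maximal ones\<close>

lemma nonzero_paths_eq: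
  "nonzero_paths = (\<lambda>u. (u, [])) ` verts G \<union> (\<lambda>p. (tail G (hd p), p)) ` C.chains"
  by (auto simp: nonzero_paths_alt C.chains_def image_iff split: if_splits)

lemma card_nonzero_paths:
  "card nonzero_paths = card (verts G) + (\<Sum>p\<in>C.maximal_chains. length p * (length p + 1) div 2)"
proof -
  have "(\<lambda>u. (u, [])) ` verts G \<inter> (\<lambda>p. (tail G (hd p), p)) ` C.chains = {}"
    by (auto simp: C.chains_def)
  then have "card nonzero_paths =
      card ((\<lambda>u. (u, [] :: 'e list)) ` verts G) + card ((\<lambda>p. (tail G (hd p), p)) ` C.chains)"
    unfolding nonzero_paths_eq by (intro card_Un_disjoint) (simp_all add: C.finite_chains)
  then show ?thesis
    by (simp add: card_image inj_on_def C.card_chains)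
qed

text \<open>Multiplying a nonzero path by an arrow at either end gives zero or a path that is one
  arrow longer, and the longer path is outside \<open>I\<close> exactly when \<open>follows\<close>
  holds at the new junction.\<close>

lemma maximal_paths_iff:
  assumes "p \<noteq> []"
  shows "(u, p) \<in> maximal_paths G I \<longleftrightarrow> u = tail G (hd p) \<and> p \<in> C.maximal_chains"
proof -
  have left: "arrow_elem G a \<otimes>\<^bsub>PA\<^esub> path_elem (u, p) \<in> I \<longleftrightarrow> \<not> follows a (hd p)"
    if "(u, p) \<in> nonzero_paths" "a \<in> arcs G" for a
  proof (cases "head G a = u")
    case True
    then have "(tail G a, a # p) \<in> quiver_paths G" using that nonzero_pathsD by auto
    with True that assms show ?thesis
      by (simp add: arrow_elem_mult_path_elem path_elem_mem_I_iff nonzero_paths_alt successively_Cons)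
  next
    case False
    with that assms show ?thesis
      by (auto simp: arrow_elem_mult_path_elem zero_mem_I follows_def nonzero_paths_alt)
  qed
  have right: "path_elem (u, p) \<otimes>\<^bsub>PA\<^esub> arrow_elem G a \<in> I \<longleftrightarrow> \<not> follows (last p) a"
    if "(u, p) \<in> nonzero_paths" "a \<in> arcs G" for a
  proof (cases "awlast u p = tail G a")
    case True
    then have "(u, p @ [a]) \<in> quiver_paths G"
      using that nonzero_pathsD by (auto simp: quiver_paths_append_iff)
    with True that assms show ?thesis
      by (simp add: path_elem_mult_arrow_elem path_elem_mem_I_iff nonzero_paths_alt
          successively_append_iff)
  next
    case False
    with that assms show ?thesis
      by (auto simp: path_elem_mult_arrow_elem zero_mem_I follows_def awalk_verts_conv)
  qed
  have "(u, p) \<in> maximal_paths G I \<longleftrightarrow> (u, p) \<in> nonzero_paths \<and>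
      (\<forall>a\<in>arcs G. \<not> follows a (hd p) \<and> \<not> follows (last p) a)"
    unfolding maximal_paths_def using left right path_elem_mem_I_iff nonzero_pathsD by blast
  then show ?thesis
    using assms by (auto simp: nonzero_paths_alt C.maximal_chains_def C.chains_def)
qed

lemma maximal_paths_subset: "maximal_paths G I \<subseteq> nonzero_paths"
  using path_elem_mem_I_iff by (auto simp: maximal_paths_def)

section \<open>The submodules of the module generated by the first arrow\<close>

context
  fixes p assumes p: "p \<in> C.maximal_chains"
begin

text \<open>\<open>initial 0\<close> is the trivial path, whose class is not in the module of the
  first arrow, and beyond \<open>length p\<close> the value stays the whole path. The relevant
  indices are therefore 1 to \<open>length p\<close>.\<close>

definition initial :: "nat \<Rightarrow> 'v \<times> 'e list" where
  "initial l = (tail G (hd p), take l p)"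

lemma p_chain: "p \<noteq> []" "set p \<subseteq> arcs G" "successively follows p"
  using p by (auto simp: C.maximal_chains_def C.chains_def)

lemma p_nth: "l < length p \<Longrightarrow> p ! l \<in> arcs G"
  using p_chain by auto

lemma p_follows: "Suc l < length p \<Longrightarrow> follows (p ! l) (p ! Suc l)"
  using p_chain by (simp add: successively_conv_nth)

lemma initial_nonzero: "0 < l \<Longrightarrow> initial l \<in> nonzero_paths"
proof -
  assume "0 < l"
  have "(tail G (hd p), take l p @ drop l p) \<in> nonzero_paths"
    using p_chain by (simp add: nonzero_paths_alt)
  then show ?thesis unfolding initial_def by (rule nonzero_paths_appendD)
qed

lemma initial_carrier: "0 < l \<Longrightarrow> path_elem (initial l) \<in> carrier PA"
  using initial_nonzero by (simp add: path_elem_carrier nonzero_pathsD)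

lemma initial_eq_iff:
  "l \<le> length p \<Longrightarrow> l' \<le> length p \<Longrightarrow> initial l = initial l' \<longleftrightarrow> l = l'"
  by (auto simp: initial_def dest: arg_cong[of _ _ length])

lemma initial_mult_arrow_elem:
  assumes "0 < l" "l < length p"
  shows "path_elem (initial l) \<otimes>\<^bsub>PA\<^esub> arrow_elem G (p ! l) = path_elem (initial (Suc l))"
proof -
  have "(tail G (hd p), take l p @ [p ! l]) \<in> quiver_paths G"
    using nonzero_pathsD[OF initial_nonzero[of "Suc l"]] assms
    by (simp add: initial_def take_Suc_conv_app_nth)
  then show ?thesis
    using assms by (auto simp: initial_def path_elem_mult_arrow_elem take_Suc_conv_app_nth
        quiver_paths_append_iff)
qed

text \<open>By maximality of \<open>p\<close>, a nonzero continuation of an initial segment cannot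
  leave \<open>p\<close>.\<close>

lemma initial_extension:
  assumes "k \<le> l" "0 < l" "l \<le> length p" "(tail G (hd p), take l p @ q) \<in> nonzero_paths"
  shows "(tail G (hd p), take l p @ q) \<in> initial ` {k..length p}"
proof -
  have "take l p @ q \<noteq> []" using assms(2) p_chain by auto
  with assms(4) have "successively follows (take l p @ q)" "set q \<subseteq> arcs G"
    by (auto simp: nonzero_paths_alt)
  from C.maximal_chain_extension[OF p assms(2,3) this] obtain l'
    where "l' \<in> {l..length p}" "take l p @ q = take l' p" by blast
  then show ?thesis using assms(1) by (auto simp: initial_def)
qed

lemma right_submodule_initial:
  assumes "0 < k"
  shows "right_submodule QA (path_span (initial ` {k..length p}))"
proof (rule right_submodule_path_span)
  fix u r q assume "(u, r) \<in> initial ` {k..length p}" "(u, r @ q) \<in> nonzero_paths"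
  then show "(u, r @ q) \<in> initial ` {k..length p}"
    using initial_extension assms by (auto simp: initial_def)
qed

lemma initial_submodule_step:
  assumes N: "right_submodule QA N" and l: "0 < l" "l < length p"
    and mem: "cls (path_elem (initial l)) \<in> N"
  shows "cls (path_elem (initial (Suc l))) \<in> N"
proof -
  have arrow: "arrow_elem G (p ! l) \<in> carrier PA" using l p_nth by (simp add: arrow_elem_carrier)
  have "cls (path_elem (initial l)) \<otimes>\<^bsub>QA\<^esub> cls (arrow_elem G (p ! l)) \<in> N"
    using right_submodule_closed(4)[OF N mem cls_carrier[OF arrow]] .
  then show ?thesis
    using l by (simp add: cls_mult arrow initial_carrier initial_mult_arrow_elem)
qed

lemma initial_submodule_le:
  assumes "right_submodule QA N" "0 < k" "k \<le> l" "l \<le> length p"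
    and "cls (path_elem (initial k)) \<in> N"
  shows "cls (path_elem (initial l)) \<in> N"
  using assms(3,4)
proof (induction l rule: dec_induct)
  case base
  then show ?case using assms by simp
next
  case (step l)
  then show ?case using initial_submodule_step[OF assms(1), of l] assms(2) by simp
qed

text \<open>Multiplying \<open>initial k\<close> by the successive arrows of \<open>p\<close>
  reaches every longer initial segment. The membership is conditional because for \<open>k\<close>
  beyond \<open>length p\<close> the index interval is empty and the span is zero.\<close>

lemma path_span_initial_subset:
  assumes "right_submodule QA N" "0 < k"
    and "k \<le> length p \<Longrightarrow> cls (path_elem (initial k)) \<in> N"
  shows "path_span (initial ` {k..length p}) \<subseteq> N"
  using assms initial_submodule_le[OF assms(1,2)] initial_nonzero
  by (intro path_span_subset_right_submodule) auto

text \<open>The first arrow is \<open>initial 1\<close>. Its class lies in the span, which is a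
  right submodule; conversely the principal module contains this class and hence the whole
  span.\<close>

lemma first_arrow_module_eq:
  "first_arrow_module G I (tail G (hd p), p) = path_span (initial ` {1..length p})"
proof -
  let ?a = "hd p"
  have a: "?a \<in> arcs G" using p_chain by auto
  have one: "initial 1 = (tail G ?a, [?a])" using p_chain(1) by (simp add: initial_def take_Suc)
  have U: "first_arrow_module G I (tail G ?a, p) =
      {cls (arrow_elem G ?a) \<otimes>\<^bsub>QA\<^esub> x |x. x \<in> carrier QA}" (is "_ = ?U")
    using p_chain(1) by (cases p) (simp_all add: first_arrow_module_def)
  have ca: "cls (arrow_elem G ?a) \<in> carrier QA" using a by (simp add: arrow_elem_carrier cls_carrier)
  have "cls (arrow_elem G ?a) \<in> path_span (initial ` {1..length p})"
  proof (subst cls_in_path_span_iff)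
    have "initial 1 \<in> initial ` {1..length p}" using p_chain(1) by (cases p) auto
    then show "\<forall>x\<in>nonzero_paths - initial ` {1..length p}. arrow_elem G ?a x = 0"
      unfolding one by (auto simp: arrow_elem_def path_elem_def)
  qed (rule arrow_elem_carrier[OF a])
  then have "?U \<subseteq> path_span (initial ` {1..length p})"
    using right_submodule_closed(4)[OF right_submodule_initial[of 1]] by auto
  moreover have "path_span (initial ` {1..length p}) \<subseteq> ?U"
  proof (rule path_span_initial_subset)
    show "right_submodule QA ?U" using ca by (rule Q.right_submodule_principal)
    have "cls (arrow_elem G ?a) \<otimes>\<^bsub>QA\<^esub> \<one>\<^bsub>QA\<^esub> \<in> ?U" by blast
    then show "cls (path_elem (initial 1)) \<in> ?U"
      unfolding one using ca by (simp add: arrow_elem_def)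
  qed simp
  ultimately show ?thesis using U by simp
qed

text \<open>
  Multiplication by the arrow following \<open>initial k\<close> kills all longer initial segments modulo \<open>I\<close>, since
  that arrow occurs in \<open>p\<close> only once. This isolates the coefficient of \<open>f\<close> at \<open>initial k\<close>.
\<close>

lemma leading_initial_mem:
  assumes N: "right_submodule QA N" and k: "0 < k" "k \<le> length p"
    and f: "f \<in> carrier PA" "cls f \<in> N" "\<And>x. x \<in> nonzero_paths - initial ` {k..length p} \<Longrightarrow> f x = 0"
    and nz: "f (initial k) \<noteq> 0"
  shows "cls (path_elem (initial k)) \<in> N"
proof -
  \<comment> \<open>For \<open>k = length p\<close> there is no next arrow, and no longer initial
    segment has to be removed from \<open>f\<close>.\<close>
  have next_mem: "cls (path_elem (initial (Suc k))) \<in> N" if less: "k < length p"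
  proof -
    let ?a = "p ! k"
    let ?g = "f \<otimes>\<^bsub>PA\<^esub> arrow_elem G ?a"
    have a: "arrow_elem G ?a \<in> carrier PA" using less p_nth by (simp add: arrow_elem_carrier)
    have g: "?g \<in> carrier PA" "cls ?g \<in> N"
      using f(1) a right_submodule_closed(4)[OF N f(2) cls_carrier[OF a]] by (simp_all add: cls_mult)
    have "?g x = f (initial k) * path_elem (initial (Suc k)) x" if x: "x \<in> nonzero_paths" for x
    proof (cases "x = initial (Suc k)")
      case True
      have "(tail G (hd p), take k p @ [?a]) \<in> quiver_paths G"
        using nonzero_pathsD[OF x] less by (simp add: True initial_def take_Suc_conv_app_nth)
      then have "awlast (tail G (hd p)) (take k p) = tail G ?a" by (simp add: quiver_paths_append_iff)
      then have "?g (tail G (hd p), take k p @ [?a]) = f (tail G (hd p), take k p)"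
        by (simp add: arrow_elem_def path_algebra_mult_path_elem)
      then show ?thesis
        using less by (simp add: True path_elem_def) (simp add: initial_def take_Suc_conv_app_nth)
    next
      case False
      have "?g x = 0"
      proof (rule ccontr)
        assume nonzero: "?g x \<noteq> 0"
        obtain u r where ur: "x = (u, r)" by force
        from nonzero obtain r' q where r: "r = r' @ q" "f (u, r') \<noteq> 0"
          "arrow_elem G ?a (awlast u r', q) \<noteq> (0 :: 'k)"
          unfolding ur by (rule path_algebra_mult_nonzeroE)
        then have q: "q = [?a]" by (auto simp: arrow_elem_def path_elem_def split: if_splits)
        have "(u, r') \<in> nonzero_paths" using x nonzero_paths_appendD(1)[of u r' q] by (simp add: ur r)
        then have "(u, r') \<in> initial ` {k..length p}" using f(3)[of "(u, r')"] r(2) by blast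
        then obtain l where l: "k \<le> l" "l \<le> length p" "u = tail G (hd p)" "r' = take l p"
          by (auto simp: initial_def)
        have "x = (u, take l p @ [?a])" using ur r q l by simp
        with x have "successively follows (take l p @ [?a])" by (simp add: nonzero_paths_def)
        then have "follows (last (take l p)) ?a"
          using l k by (auto simp: successively_append_iff)
        then have "follows (p ! (l - 1)) ?a"
          using l(1,2) k p_chain(1) last_conv_nth[of "take l p"] by auto
        \<comment> \<open>The predecessor of \<open>?a\<close> is unique and occurs at only one
          position of the maximal chain \<open>p\<close>, which forces \<open>l = k\<close>.\<close>
        moreover have "follows (p ! (k - 1)) ?a" using p_follows[of "k - 1"] k less by simp
        ultimately have "p ! (l - 1) = p ! (k - 1)" by (rule C.left_unique)
        then have "l - 1 = k - 1"
          using C.maximal_chain_unique(1)[OF p p, of "l - 1" "k - 1"] l k by simp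
        then have "l = k" using l k by simp
        then have "x = initial (Suc k)"
          using ur r q l less by (simp add: initial_def take_Suc_conv_app_nth)
        with False show False by simp
      qed
      with False show ?thesis by (simp add: path_elem_def)
    qed
    \<comment> \<open>Dividing by the coefficient at \<open>initial k\<close> turns the class of
      \<open>?g\<close> into that of \<open>initial (Suc k)\<close>.\<close>
    then have "inverse (f (initial k)) * ?g x = path_elem (initial (Suc k)) x" if "x \<in> nonzero_paths" for x
      using that nz by simp
    moreover have "(\<lambda>x. inverse (f (initial k)) * ?g x) \<in> carrier PA"
      using g(1) by (rule carrier_restrict) auto
    ultimately have "cls (\<lambda>x. inverse (f (initial k)) * ?g x) = cls (path_elem (initial (Suc k)))"
      using initial_carrier[of "Suc k"] by (subst cls_eq_iff) auto
    then show ?thesis using right_submodule_scale[OF N g, of "inverse (f (initial k))"] by simp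
  qed
  \<comment> \<open>The remaining terms of \<open>f\<close> lie in the span of the longer initial segments, hence in \<open>N\<close>.\<close>
  let ?h = "\<lambda>x. if x = initial k then 0 else - f x"
  have h: "?h \<in> carrier PA" using f(1) by (rule carrier_restrict) (auto split: if_splits)
  have sub: "path_span (initial ` {Suc k..length p}) \<subseteq> N"
    using next_mem by (intro path_span_initial_subset[OF N]) auto
  have "?h x = 0" if x: "x \<in> nonzero_paths - initial ` {Suc k..length p}" for x
  proof (cases "x = initial k")
    case False
    have "{k..length p} = insert k {Suc k..length p}" using k by auto
    with x False have "x \<in> nonzero_paths - initial ` {k..length p}" by auto
    then show ?thesis using f(3) by simp
  qed simp
  then have "cls ?h \<in> path_span (initial ` {Suc k..length p})" using h by (simp add: cls_in_path_span_iff)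
  then have "cls f \<oplus>\<^bsub>QA\<^esub> cls ?h \<in> N" using sub right_submodule_closed(2)[OF N f(2)] by blast
  then have sum_mem: "cls (\<lambda>x. f x + ?h x) \<in> N" using f(1) h by (simp add: cls_add)
  have "cls (\<lambda>x. inverse (f (initial k)) * (f x + ?h x)) \<in> N"
    by (rule right_submodule_scale[OF N carrier_add[OF f(1) h] sum_mem])
  moreover have "(\<lambda>x. inverse (f (initial k)) * (f x + ?h x)) = path_elem (initial k)"
    using nz by (auto simp: path_elem_def)
  ultimately show ?thesis by simp
qed

text \<open>Take the smallest \<open>k\<close> such that some element of \<open>N\<close> has a
  nonzero coefficient at \<open>initial k\<close>. Then \<open>N\<close> lies in the span of the
  initial segments from \<open>k\<close> on, and \<open>leading_initial_mem\<close> puts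
  \<open>initial k\<close>, which generates this span, into \<open>N\<close>.\<close>

lemma right_submodules_of_initial:
  assumes N: "right_submodule QA N" "N \<subseteq> path_span (initial ` {1..length p})"
  shows "\<exists>k\<in>{1..Suc (length p)}. N = path_span (initial ` {k..length p})"
proof -
  define leading where "leading k \<longleftrightarrow> 0 < k \<and> k \<le> Suc (length p) \<and>
    (k = Suc (length p) \<or> (\<exists>f\<in>carrier PA. cls f \<in> N \<and> f (initial k) \<noteq> 0))" for k
  define k where "k = (LEAST k. leading k)"
  have "leading (Suc (length p))" by (simp add: leading_def)
  then have k: "leading k" unfolding k_def by (rule LeastI)
  \<comment> \<open>Initial segments shorter than \<open>k\<close> are excluded by minimality, all
    other paths by the hypothesis on \<open>N\<close>.\<close>
  have zero: "f x = 0"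
    if f: "f \<in> carrier PA" "cls f \<in> N" and x: "x \<in> nonzero_paths - initial ` {k..length p}" for f x
  proof (cases "x \<in> initial ` {1..length p}")
    case True
    then obtain l where l: "x = initial l" "0 < l" "l \<le> length p" by auto
    then have "l < k" using x by force
    then have "\<not> leading l" unfolding k_def by (rule not_less_Least)
    then show ?thesis using f l by (auto simp: leading_def)
  next
    case False
    then show ?thesis using f N(2) x cls_in_path_span_iff by blast
  qed
  have "N \<subseteq> path_span (initial ` {k..length p})"
  proof
    fix v assume v: "v \<in> N"
    then obtain f where f: "f \<in> carrier PA" "v = cls f"
      using right_submodule_closed(3)[OF N(1)] by (auto simp: carrier_QA)
    then show "v \<in> path_span (initial ` {k..length p})"
      using zero[OF f(1)] v by (simp add: cls_in_path_span_iff)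
  qed
  moreover have "path_span (initial ` {k..length p}) \<subseteq> N"
  proof (rule path_span_initial_subset[OF N(1)])
    show "0 < k" using k by (simp add: leading_def)
    assume "k \<le> length p"
    with k obtain f where "f \<in> carrier PA" "cls f \<in> N" "f (initial k) \<noteq> 0"
      by (auto simp: leading_def)
    with \<open>k \<le> length p\<close> \<open>0 < k\<close> show "cls (path_elem (initial k)) \<in> N"
      using leading_initial_mem[OF N(1)] zero by blast
  qed
  ultimately show ?thesis using k by (auto simp: leading_def)
qed

lemma first_arrow_module_maximal_chain:
  "uniserial QA (first_arrow_module G I (tail G (hd p), p))"
  "module_length QA (first_arrow_module G I (tail G (hd p), p)) = length p"
proof -
  \<comment> \<open>\<open>F i\<close> is spanned by the \<open>i\<close> longest initial segments,
    so that the chain increases from zero to the whole module.\<close>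
  define F where "F i = path_span (initial ` {Suc (length p) - i..length p})" for i
  note chain = uniserial_if_submodules_chain[of F QA "length p" "first_arrow_module G I (tail G (hd p), p)"]
  have 1: "F 0 = {\<zero>\<^bsub>QA\<^esub>}" by (simp add: F_def path_span_empty)
  have 2: "F (length p) = first_arrow_module G I (tail G (hd p), p)"
    by (simp add: F_def first_arrow_module_eq)
  have 3: "right_submodule QA (F i)" if "i \<le> length p" for i
    unfolding F_def using that by (intro right_submodule_initial) simp
  have 4: "F i \<subset> F (Suc i)" if "i < length p" for i
  proof
    show "F i \<subseteq> F (Suc i)" unfolding F_def by (intro path_span_mono) auto
    \<comment> \<open>This is the length of the one initial segment that \<open>F (Suc i)\<close>
      gains over \<open>F i\<close>; its class separates the two.\<close>
    let ?l = "length p - i"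
    have "initial ?l \<notin> initial ` {Suc (length p) - i..length p}"
      using that by (auto simp: initial_eq_iff)
    moreover have "0 < ?l" using that by simp
    ultimately have "cls (path_elem (initial ?l)) \<notin> F i"
      unfolding F_def using cls_in_path_span_iff[OF initial_carrier] initial_nonzero
      by (auto simp: path_elem_def)
    moreover have "initial ?l \<in> initial ` {Suc (length p) - Suc i..length p}" using that by auto
    then have "cls (path_elem (initial ?l)) \<in> F (Suc i)"
      unfolding F_def using cls_in_path_span_iff[OF initial_carrier[OF \<open>0 < ?l\<close>]]
      by (auto simp: path_elem_def)
    ultimately show "F i \<noteq> F (Suc i)" by blast
  qed
  have 5: "\<exists>i\<le>length p. N = F i"
    if N: "right_submodule QA N" "N \<subseteq> first_arrow_module G I (tail G (hd p), p)" for N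
  proof -
    have "N \<subseteq> path_span (initial ` {1..length p})"
      using N(2) by (simp add: first_arrow_module_eq)
    from right_submodules_of_initial[OF N(1) this] obtain k
      where "k \<in> {1..Suc (length p)}" "N = path_span (initial ` {k..length p})" ..
    then show ?thesis
      by (intro exI[of _ "Suc (length p) - k"]) (auto simp: F_def)
  qed
  show "uniserial QA (first_arrow_module G I (tail G (hd p), p))"
    "module_length QA (first_arrow_module G I (tail G (hd p), p)) = length p"
    using chain[OF 1 2 3 4 5] by auto
qed

end

section \<open>Maximal paths in the dimension formula\<close>

lemma first_arrow_module_trivial:
  "uniserial QA (first_arrow_module G I (u, []))"
  "module_length QA (first_arrow_module G I (u, [])) = 0"
proof -
  have zero: "right_submodule QA {\<zero>\<^bsub>QA\<^esub>}"
    using right_submodule_path_span[of "{}"] by (simp add: path_span_empty)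
  have "N = {\<zero>\<^bsub>QA\<^esub>}" if "right_submodule QA N" "N \<subseteq> {\<zero>\<^bsub>QA\<^esub>}" for N
    using that right_submodule_closed(1)[OF that(1)] by blast
  then show "uniserial QA (first_arrow_module G I (u, []))"
    "module_length QA (first_arrow_module G I (u, [])) = 0"
    using uniserial_if_submodules_chain[of "\<lambda>_. {\<zero>\<^bsub>QA\<^esub>}" QA 0 "{\<zero>\<^bsub>QA\<^esub>}"] zero
    by (simp_all add: first_arrow_module_def)
qed

lemma uniserial_first_arrow_module:
  assumes "m \<in> maximal_paths G I"
  shows "uniserial QA (first_arrow_module G I m)"
  using assms maximal_paths_iff[of "snd m" "fst m"] first_arrow_module_trivial(1)[of "fst m"]
    first_arrow_module_maximal_chain(1)[of "snd m"]
  by (cases "snd m = []") (metis prod.collapse)+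

text \<open>A trivial maximal path has the zero module, of length 0, so \<open>c 0 = 0\<close> makes
  its summand vanish. The other maximal paths correspond bijectively to the maximal chains.\<close>

lemma sum_maximal_paths:
  fixes c :: "nat \<Rightarrow> nat"
  assumes "c 0 = 0"
  shows "(\<Sum>m\<in>maximal_paths G I. c (module_length QA (first_arrow_module G I m))) =
    (\<Sum>p\<in>C.maximal_chains. c (length p))"
proof -
  let ?M = "(\<lambda>p. (tail G (hd p), p)) ` C.maximal_chains"
  have "finite (maximal_paths G I)"
    using finite_nonzero_paths maximal_paths_subset by (rule rev_finite_subset)
  moreover have "?M \<subseteq> maximal_paths G I"
    using maximal_paths_iff by (auto simp: C.maximal_chains_def C.chains_def)
  moreover have "\<forall>m\<in>maximal_paths G I - ?M. c (module_length QA (first_arrow_module G I m)) = 0"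
  proof
    fix m assume m: "m \<in> maximal_paths G I - ?M"
    obtain u p where up: "m = (u, p)" by force
    with m have "p = []" using maximal_paths_iff[of p u] by auto
    then show "c (module_length QA (first_arrow_module G I m)) = 0"
      using up assms by (simp add: first_arrow_module_trivial)
  qed
  ultimately have "(\<Sum>m\<in>maximal_paths G I. c (module_length QA (first_arrow_module G I m))) =
      (\<Sum>m\<in>?M. c (module_length QA (first_arrow_module G I m)))"
    by (rule sum.mono_neutral_right)
  also have "\<dots> = (\<Sum>p\<in>C.maximal_chains. c (length p))"
    by (subst sum.reindex) (auto simp: inj_on_def first_arrow_module_maximal_chain intro: sum.cong)
  finally show ?thesis .
qed

text \<open>The span of all nonzero paths is the whole quotient, so the dimension is their number;
  \<open>sum_maximal_paths\<close> converts lengths of chains into lengths of modules.\<close>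

lemma dimension_formula:
  "ring.dimension QA
     (card (verts G) + (\<Sum>m\<in>maximal_paths G I.
        module_length QA (first_arrow_module G I m) *
        (module_length QA (first_arrow_module G I m) + 1) div 2))
     (base_field G I) (carrier QA)"
  using dimension_path_span[OF finite_nonzero_paths order_refl]
    sum_maximal_paths[of "\<lambda>n. n * (n + 1) div 2"]
  by (simp only: card_nonzero_paths path_span_nonzero_paths)

end

theorem corollary2p7:
  fixes G :: "('v, 'e) pre_digraph"
    and I :: "('v \<times> 'e list \<Rightarrow> 'k::field) set"
  assumes "fin_digraph G"
    and "admissible_ideal G I"
    and "indecomposable_ring (quiver_algebra G I)"
    and "almost_gentle G I"
  shows "(\<forall>m\<in>maximal_paths G I. uniserial (quiver_algebra G I) (first_arrow_module G I m)) \<and>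
    ring.dimension (quiver_algebra G I)
      (card (verts G) +
        (\<Sum>m\<in>maximal_paths G I.
           module_length (quiver_algebra G I) (first_arrow_module G I m) *
           (module_length (quiver_algebra G I) (first_arrow_module G I m) + 1) div 2))
      (base_field G I) (carrier (quiver_algebra G I))"
proof -
  obtain S where S: "S \<subseteq> {x \<in> quiver_paths G. length (snd x) = 2}"
    "I = Idl\<^bsub>path_algebra G\<^esub> (path_elem ` S)"
    using assms(4) unfolding almost_gentle_def by blast
  interpret almost_gentle_presentation G I S
    using assms S by (intro almost_gentle_presentation.intro quadratic_monomial.intro
        quadratic_monomial_axioms.intro almost_gentle_presentation_axioms.intro)
  show ?thesis using uniserial_first_arrow_module dimension_formula by blast
qed

end
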